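(* Let $g \in L^2(\mathbb{R})$, $a,b>0$, and suppose that $$A:=\inf_{x\in[0,a]\setminus N_G}\left[\sum_{n\in\mathbb{Z}}|g(x-na)|^2-\sum_{k\neq 0}\left|\sum_{n\in\mathbb{Z}} g(x-na)\overline{g(x-na-\tfrac{k}{b})}\right|\right]>0$$ and $$B:=\sup_{x\in[0,a]}\sum_{k\in\mathbb{Z}}\left|\sum_{n\in\mathbb{Z}} g(x-na)\overline{g(x-na-\tfrac{k}{b})}\right|<\infty .$$ Then $\{E_{mb}T_{na}g\}_{m,n\in\mathbb{Z}}$ is a frame for $L^2(\mathbb{R}\setminus N_G)$ with bounds $\frac{A}{b},\frac{B}{b}$.
   Context: For $f\in L^2(\mathbb{R})$ (Lebesgue measure, complex-valued functions) and $c\in\mathbb{R}$, define translation $(T_cf)(x)=f(x-c)$ and modulation $(E_cf)(x)=e^{2\pi i c x}f(x)$; thus $(E_{mb}T_{na}g)(x)=e^{2\pi i m b x}g(x-na)$. Define $G:\mathbb{R}\to[0,\infty]$, $G(x)=\sum_{n\in\mathbb{Z}}|g(x-na)|^2$, and $N_G=\{x\in\mathbb{R}: G(x)=0\}$. $L^2(\mathbb{R}\setminus N_G)$ denotes the subspace of functions in $L^2(\mathbb{R})$ that vanish on $N_G$. The sum over $k\neq0$ is over nonzero integers $k$. A countable family $\{g_i\}_{i\in I}$ in a separable Hilbert space $\mathcal{H}$ is a frame for $\mathcal{H}$ with bounds $A,B>0$ if $A\|f\|^2\le\sum_{i\in I}|\langle f,g_i\rangle|^2\le B\|f\|^2$ for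 all $f\in\mathcal{H}$. The bounds need not be optimal. *)

theory Defs
  imports "HOL-Analysis.Analysis"
begin

text \<open>
  Elements of \<open>L\<^sup>2(\<real>)\<close> are represented by Lebesgue measurable functions, not by classes modulo null
  sets: \<open>G\<close>, \<open>N\<^sub>G\<close> and the series below are evaluated at every point of one fixed representative.
  Consequently \<open>L2_inner\<close> is definite only up to almost everywhere equality.
\<close>

definition L2 :: "(real \<Rightarrow> complex) set" where
  "L2 = {f. f \<in> borel_measurable lebesgue \<and> integrable lebesgue (\<lambda>x. (cmod (f x))\<^sup>2)}"

definition L2_inner :: "(real \<Rightarrow> complex) \<Rightarrow> (real \<Rightarrow> complex) \<Rightarrow> complex" where
  "L2_inner f g = (LINT x|lebesgue. f x * cnj (g x))"

text \<open>The space \<open>L\<^sup>2(\<real> - N)\<close>: membership must not depend on the representative, so vanishing on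
  \<open>N\<close> is understood almost everywhere.\<close>

definition L2_off :: "real set \<Rightarrow> (real \<Rightarrow> complex) set" where
  "L2_off N = {f \<in> L2. AE x in lebesgue. x \<in> N \<longrightarrow> f x = 0}"

text \<open>A space is given by its carrier \<open>H\<close> and its inner product \<open>ip\<close>; thus \<open>Re (ip f f)\<close> is the
  squared norm of \<open>f\<close>.\<close>

definition frame_with_bounds ::
    "('v \<Rightarrow> 'v \<Rightarrow> complex) \<Rightarrow> 'v set \<Rightarrow> 'i set \<Rightarrow> ('i \<Rightarrow> 'v) \<Rightarrow> real \<Rightarrow> real \<Rightarrow> bool" where
  "frame_with_bounds ip H I \<phi> A B \<longleftrightarrow>
     countable I \<and> \<phi> ` I \<subseteq> H \<and> 0 < A \<and> 0 < B \<and>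
     (\<forall>f\<in>H. (\<lambda>i. (cmod (ip f (\<phi> i)))\<^sup>2) summable_on I \<and>
        A * Re (ip f f) \<le> (\<Sum>\<^sub>\<infinity>i\<in>I. (cmod (ip f (\<phi> i)))\<^sup>2) \<and>
        (\<Sum>\<^sub>\<infinity>i\<in>I. (cmod (ip f (\<phi> i)))\<^sup>2) \<le> B * Re (ip f f))"

definition translation :: "real \<Rightarrow> (real \<Rightarrow> complex) \<Rightarrow> real \<Rightarrow> complex" where
  "translation c f = (\<lambda>x. f (x - c))"

definition modulation :: "real \<Rightarrow> (real \<Rightarrow> complex) \<Rightarrow> real \<Rightarrow> complex" where
  "modulation c f = (\<lambda>x. exp (2 * of_real pi * \<i> * of_real c * of_real x) * f x)"

definition gabor :: "(real \<Rightarrow> complex) \<Rightarrow> real \<Rightarrow> real \<Rightarrow> int \<times> int \<Rightarrow> real \<Rightarrow> complex" where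
  "gabor g a b = (\<lambda>(m, n). modulation (of_int m * b) (translation (of_int n * a) g))"

definition G_fun :: "(real \<Rightarrow> complex) \<Rightarrow> real \<Rightarrow> real \<Rightarrow> ennreal" where
  "G_fun g a x = (\<Sum>\<^sub>\<infinity>n\<in>(UNIV :: int set). ennreal ((cmod (g (x - of_int n * a)))\<^sup>2))"

definition N_G :: "(real \<Rightarrow> complex) \<Rightarrow> real \<Rightarrow> real set" where
  "N_G g a = {x. G_fun g a x = 0}"

text \<open>
  The modulus of \<open>\<Sum>\<^sub>n g(x - na) cnj (g(x - na - k/b))\<close> as an element of \<open>[0,\<infinity>]\<close>. The value \<open>\<infinity>\<close> for a
  divergent series replaces the library convention that such an infinite sum is \<open>0\<close>. It is needed
  for \<open>k = 0\<close>, where the modulus is \<open>G(x)\<close> and must be \<open>\<infinity>\<close> when \<open>G(x)\<close> is. If \<open>G\<close> is finite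
  everywhere, all these series converge absolutely.
\<close>

definition abs_corr :: "(real \<Rightarrow> complex) \<Rightarrow> real \<Rightarrow> real \<Rightarrow> int \<Rightarrow> real \<Rightarrow> ennreal" where
  "abs_corr g a b k x =
     (let h = (\<lambda>n::int. g (x - of_int n * a) * cnj (g (x - of_int n * a - of_int k / b)))
      in if h summable_on UNIV then ennreal (cmod (\<Sum>\<^sub>\<infinity>n\<in>UNIV. h n)) else \<infinity>)"

end

theory Submission
  imports Defs
begin

text \<open>
  Put \<open>L = 1/b\<close>. The inner products of \<open>f\<close> with the Gabor functions of a fixed translation index \<open>n\<close>
  are the Fourier coefficients, over one period of length \<open>L\<close>, of the periodization
  \<open>P\<^sub>n x = (\<Sum>k. f (x + k L) * cnj (g (x + k L - n a)))\<close>.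
  By Parseval's identity (\<open>parseval\<close>), the sum of the squared moduli of all inner products is \<open>L\<close> times
  the integral over a period of \<open>\<Sum>n. \<bar>P\<^sub>n x\<bar>\<^sup>2\<close>.
  
  For fixed \<open>x\<close> this integrand is the squared norm of the image of the sequence \<open>c k = f (x + k L)\<close>
  under a matrix, and its Gram matrix \<open>C k l = (\<Sum>n. g (x + k L - n a) * cnj (g (x + l L - n a)))\<close> has
  the correlation sums of the hypotheses as entries. The bound \<open>B\<close> says that all absolute row sums of
  \<open>C\<close> are at most \<open>B\<close>; the bound \<open>A\<close> says that in every row belonging to a point outside \<open>N_G\<close> the
  diagonal entry exceeds the sum of the moduli of the others by at least \<open>A\<close>. Schur's test bounds
  the quadratic form of \<open>C\<close> by \<open>B * (\<Sum>k. \<bar>c k\<bar>\<^sup>2)\<close>, and for a sequence supported off \<open>N_G\<close> it is at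
  least \<open>A * (\<Sum>k. \<bar>c k\<bar>\<^sup>2)\<close> (\<open>upper_bound\<close>, \<open>lower_bound\<close>, \<open>fiber_bounds\<close>). Integrating over a period
  turns \<open>\<Sum>k. \<bar>f (x + k L)\<bar>\<^sup>2\<close> into the squared norm of \<open>f\<close> (\<open>nn_integral_tiling\<close>), which gives the frame
  bounds \<open>A L\<close> and \<open>B L\<close>.
  
  Because the matrix estimates are made fibre by fibre on all square summable sequences, they apply
  directly to every \<open>f\<close> in the space; no dense subspace of bounded, compactly supported functions
  enters. Behind Parseval's identity stands the completeness of the trigonometric system in \<open>L\<^sup>2\<close> of a
  period (\<open>trig_approx_L2\<close>), which rests on the Stone-Weierstrass theorem and inner regularity.
\<close>

section \<open>Parseval's identity on a period\<close>

definition trig_mono :: "real \<Rightarrow> int \<Rightarrow> real \<Rightarrow> complex" where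
  "trig_mono L m x = cis (2 * pi * of_int m * x / L)"

lemma trig_mono_add: "trig_mono L (m + n) x = trig_mono L m x * trig_mono L n x"
  by (simp add: trig_mono_def cis_mult add_divide_distrib ring_distribs)

lemma trig_mono_cnj: "cnj (trig_mono L m x) = trig_mono L (- m) x"
  by (simp add: trig_mono_def cis_cnj)

lemma norm_trig_mono [simp]: "cmod (trig_mono L m x) = 1"
  by (simp add: trig_mono_def)

lemma trig_mono_0 [simp]: "trig_mono L 0 x = 1"
  by (simp add: trig_mono_def)

lemma continuous_trig_mono: "continuous_on S (trig_mono L m)"
  unfolding trig_mono_def by (cases "L = 0") (auto intro!: continuous_intros)

lemma trig_mono_measurable_lebesgue [measurable]: "trig_mono L m \<in> borel_measurable lebesgue"
  using borel_measurable_continuous_onI[OF continuous_trig_mono[of UNIV L m]]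
  by (simp add: measurable_completion)

lemma trig_mono_periodic:
  assumes "L \<noteq> 0"
  shows "trig_mono L m (x + of_int k * L) = trig_mono L m x"
proof -
  have "2 * pi * of_int m * (x + of_int k * L) / L = 2 * pi * of_int m * x / L + 2 * pi * of_int (m * k)"
    using assms by (simp add: field_simps)
  then show ?thesis
    by (simp add: trig_mono_def cis_mult [symmetric])
qed

text \<open>
  The half-open period makes the translates by multiples of \<open>L\<close> a partition of the line, and makes
  \<open>x \<mapsto> trig_mono L 1 x\<close> injective on it.
\<close>

abbreviation period_measure :: "real \<Rightarrow> real measure" where
  "period_measure L \<equiv> lebesgue_on {0..<L}"

lemma finite_measure_period: "finite_measure (period_measure L)"
  by (rule finite_measureI) (cases "0 \<le> L"; simp add: emeasure_restrict_space)

lemma trig_mono_measurable [measurable]: "trig_mono L m \<in> borel_measurable (period_measure L)"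
  by (rule continuous_imp_measurable_on_sets_lebesgue[OF continuous_trig_mono]) simp

lemma integral_trig_mono:
  assumes L: "0 < L"
  shows "(LINT x|period_measure L. trig_mono L m x) = (if m = 0 then of_real L else 0)"
proof (cases "m = 0")
  case True
  then show ?thesis using L
    by (simp add: measure_restrict_space scaleR_conv_of_real)
next
  case False
  define w where "w = 2 * pi * of_int m / L"
  have w: "w \<noteq> 0" using False L by (simp add: w_def)
  define F where "F x = cis (w * x) / (\<i> * of_real w)" for x
  have e: "trig_mono L m x = cis (w * x)" for x
    by (simp add: trig_mono_def w_def)
  have "has_bochner_integral lborel (\<lambda>x. indicator {0..L} x *\<^sub>R trig_mono L m x) (F L - F 0)"
  proof (rule has_bochner_integral_FTC_Icc)
    fix x :: real
    have "((\<lambda>x. exp (x *\<^sub>R (\<i> * of_real w)) / (\<i> * of_real w)) has_vector_derivative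
        exp (x *\<^sub>R (\<i> * of_real w)) * (\<i> * of_real w) / (\<i> * of_real w)) (at x within {0..L})"
      by (intro has_vector_derivative_divide exp_scaleR_has_vector_derivative_right)
    moreover have "exp (x *\<^sub>R (\<i> * of_real w)) = cis (w * x)" for x
      by (simp add: cis_conv_exp scaleR_conv_of_real mult_ac)
    ultimately show "(F has_vector_derivative trig_mono L m x) (at x within {0..L})"
      using w by (simp add: F_def[abs_def] e)
  qed (use L in \<open>auto intro: continuous_trig_mono\<close>)
  moreover have "F L = F 0"
    using L unfolding F_def w_def by simp
  ultimately have "(LINT x|lborel. indicator {0..L} x *\<^sub>R trig_mono L m x) = 0"
    by (simp add: has_bochner_integral_iff)
  moreover have "(\<lambda>x. indicator {0..L} x *\<^sub>R trig_mono L m x) \<in> borel_measurable lborel"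
    using borel_measurable_continuous_onI[OF continuous_trig_mono[of UNIV L m]] by auto
  ultimately have "(LINT x|lebesgue. indicator {0..L} x *\<^sub>R trig_mono L m x) = 0"
    by (simp add: integral_completion)
  moreover have "(LINT x|lebesgue. indicator {0..L} x *\<^sub>R trig_mono L m x)
      = (LINT x|lebesgue. indicator {0..<L} x *\<^sub>R trig_mono L m x)"
  proof (rule integral_cong_AE)
    have "AE x in lebesgue. x \<noteq> L"
      by (rule AE_I'[of "{L}"]) (auto simp: negligible_iff_null_sets[symmetric])
    then show "AE x in lebesgue. indicator {0..L} x *\<^sub>R trig_mono L m x = indicator {0..<L} x *\<^sub>R trig_mono L m x"
      by eventually_elim (auto simp: indicator_def)
    show "(\<lambda>x. indicator {0..L} x *\<^sub>R trig_mono L m x) \<in> borel_measurable lebesgue"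
      "(\<lambda>x. indicator {0..<L} x *\<^sub>R trig_mono L m x) \<in> borel_measurable lebesgue"
      by (simp_all add: borel_measurable_scaleR borel_measurable_indicator trig_mono_measurable_lebesgue)
  qed
  ultimately show ?thesis
    using False by (simp add: integral_restrict_space)
qed

lemma integral_trig_mono_cnj:
  assumes "0 < L"
  shows "(LINT x|period_measure L. trig_mono L m x * cnj (trig_mono L n x)) = (if m = n then of_real L else 0)"
  using integral_trig_mono[OF assms, of "m - n"] trig_mono_add[of L m "- n"]
  by (simp add: trig_mono_cnj)

definition trig_poly :: "real \<Rightarrow> (real \<Rightarrow> complex) \<Rightarrow> bool" where
  "trig_poly L p \<longleftrightarrow> (\<exists>S d. finite S \<and> p = (\<lambda>x. \<Sum>m\<in>S. d m * trig_mono L m x))"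

lemma trig_polyI: "finite S \<Longrightarrow> trig_poly L (\<lambda>x. \<Sum>m\<in>S. d m * trig_mono L m x)"
  unfolding trig_poly_def by (intro exI conjI) (assumption, rule refl)

text \<open>
  Two trigonometric polynomials can be compared or added only over a common index set, so the
  coefficients are extended by zero.
\<close>

lemma trig_polyE_superset:
  assumes "trig_poly L p" 
  obtains S d where "finite S" "\<And>T. finite T \<Longrightarrow> S \<subseteq> T \<Longrightarrow> p = (\<lambda>x. \<Sum>m\<in>T. d m * trig_mono L m x)"
proof -
  obtain S d where S: "finite S" "p = (\<lambda>x. \<Sum>m\<in>S. d m * trig_mono L m x)"
    using assms by (auto simp: trig_poly_def)
  have "p = (\<lambda>x. \<Sum>m\<in>T. (if m \<in> S then d m else 0) * trig_mono L m x)" if "finite T" "S \<subseteq> T" for T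
    unfolding S(2) by (rule ext, rule sum.mono_neutral_cong_left) (use that in auto)
  then show ?thesis by (rule that[OF S(1)])
qed

lemma trig_poly_add:
  assumes "trig_poly L p" "trig_poly L q"
  shows "trig_poly L (\<lambda>x. p x + q x)"
proof -
  obtain S d where S: "finite S" "\<And>T. finite T \<Longrightarrow> S \<subseteq> T \<Longrightarrow> p = (\<lambda>x. \<Sum>m\<in>T. d m * trig_mono L m x)"
    using assms(1) by (rule trig_polyE_superset) blast
  obtain S' d' where S': "finite S'" "\<And>T. finite T \<Longrightarrow> S' \<subseteq> T \<Longrightarrow> q = (\<lambda>x. \<Sum>m\<in>T. d' m * trig_mono L m x)"
    using assms(2) by (rule trig_polyE_superset) blast
  have "(\<lambda>x. p x + q x) = (\<lambda>x. \<Sum>m\<in>S\<union>S'. (d m + d' m) * trig_mono L m x)"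
    unfolding S(2)[of "S \<union> S'", OF finite_UnI[OF S(1) S'(1)] Un_upper1]
      S'(2)[of "S \<union> S'", OF finite_UnI[OF S(1) S'(1)] Un_upper2]
    by (simp add: sum.distrib ring_distribs)
  then show ?thesis
    using trig_polyI[OF finite_UnI[OF S(1) S'(1)]] by simp
qed

lemma trig_poly_scaled_mono: "trig_poly L (\<lambda>x. c * trig_mono L m x)"
  unfolding trig_poly_def by (rule exI[of _ "{m}"], rule exI[of _ "\<lambda>_. c"]) simp

lemma trig_poly_const: "trig_poly L (\<lambda>x. c)"
  using trig_poly_scaled_mono[of L c 0] by simp

lemma trig_poly_sum:
  assumes "finite I" "\<And>i. i \<in> I \<Longrightarrow> trig_poly L (p i)"
  shows "trig_poly L (\<lambda>x. \<Sum>i\<in>I. p i x)"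
  using assms by (induction I) (auto intro: trig_poly_add trig_poly_const)

lemma trig_poly_mult:
  assumes "trig_poly L p" "trig_poly L q"
  shows "trig_poly L (\<lambda>x. p x * q x)"
proof -
  obtain S d S' d' where S: "finite S" "p = (\<lambda>x. \<Sum>m\<in>S. d m * trig_mono L m x)"
    "finite S'" "q = (\<lambda>x. \<Sum>m\<in>S'. d' m * trig_mono L m x)"
    using assms unfolding trig_poly_def by blast
  have "(\<lambda>x. p x * q x) = (\<lambda>x. \<Sum>m\<in>S. \<Sum>n\<in>S'. (d m * d' n) * trig_mono L (m + n) x)"
    unfolding S(2,4) sum_product by (simp add: trig_mono_add mult_ac)
  then show ?thesis
    using S(1,3) by (simp add: trig_poly_sum trig_poly_scaled_mono)
qed

lemma trig_poly_measurable:
  assumes "trig_poly L p"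
  shows "p \<in> borel_measurable (period_measure L)"
  using assms unfolding trig_poly_def by auto

text \<open>
  A real polynomial in the coordinates of a point \<open>z\<close> of the unit circle is a Laurent polynomial in \<open>z\<close>,
  because \<open>Re z\<close> and \<open>Im z\<close> are combinations of \<open>z\<close> and \<open>cnj z\<close>. This is what lets the
  Stone-Weierstrass theorem speak about trigonometric polynomials.
\<close>

lemma trig_poly_real_polynomial:
  assumes "real_polynomial_function (p :: complex \<Rightarrow> real)"
  shows "trig_poly L (\<lambda>x. of_real (p (trig_mono L 1 x)))"
  using assms
proof induction
  case (linear f)
  have "of_real (f z) = (of_real (f 1) - \<i> * of_real (f \<i>)) / 2 * z + (of_real (f 1) + \<i> * of_real (f \<i>)) / 2 * cnj z" for z
  proof -
    have "f (Re z *\<^sub>R 1 + Im z *\<^sub>R \<i>) = Re z * f 1 + Im z * f \<i>"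
      using linear by (simp add: bounded_linear.linear linear_add linear_scale)
    moreover have "Re z *\<^sub>R 1 + Im z *\<^sub>R \<i> = z"
      by (simp add: complex_eq_iff)
    ultimately have "f z = Re z * f 1 + Im z * f \<i>"
      by simp
    then show ?thesis
      by (simp add: complex_eq_iff field_simps)
  qed
  note this[of "trig_mono L 1 x" for x]
  then show ?case
    by (simp only: trig_mono_cnj) (intro trig_poly_add trig_poly_scaled_mono)
next
  case (const c)
  show ?case by (rule trig_poly_const)
next
  case (add f g)
  then show ?case using trig_poly_add by simp
next
  case (mult f g)
  then show ?case using trig_poly_mult by simp
qed

text \<open>
  The closure of the trigonometric polynomials in \<open>L\<^sup>2\<close> of the period. Nonnegative integrals are used so
  that closeness can be stated before square integrability is known.
\<close>

definition trig_approx :: "real \<Rightarrow> (real \<Rightarrow> complex) \<Rightarrow> bool" where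
  "trig_approx L f \<longleftrightarrow> f \<in> borel_measurable (period_measure L) \<and>
     (\<forall>\<epsilon>>0. \<exists>p. trig_poly L p \<and> (\<integral>\<^sup>+x. ennreal ((cmod (f x - p x))\<^sup>2) \<partial>period_measure L) < ennreal \<epsilon>)"

lemma power2_norm_add_le: "(norm (u + v))\<^sup>2 \<le> 2 * (norm u)\<^sup>2 + 2 * (norm v)\<^sup>2"
  for u v :: "'a::real_normed_vector"
proof -
  have "(norm (u + v))\<^sup>2 \<le> (norm u + norm v)\<^sup>2"
    by (intro power_mono norm_triangle_ineq) simp
  also have "\<dots> \<le> 2 * (norm u)\<^sup>2 + 2 * (norm v)\<^sup>2"
    using sum_squares_bound[of "norm u" "norm v"] by (simp add: power2_sum)
  finally show ?thesis .
qed

lemma nn_integral_square_add_le: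
  assumes [measurable]: "f \<in> borel_measurable M" "g \<in> borel_measurable M"
  shows "(\<integral>\<^sup>+x. ennreal ((cmod (f x + g x))\<^sup>2) \<partial>M)
    \<le> 2 * (\<integral>\<^sup>+x. ennreal ((cmod (f x))\<^sup>2) \<partial>M) + 2 * (\<integral>\<^sup>+x. ennreal ((cmod (g x))\<^sup>2) \<partial>M)"
proof -
  have "(\<integral>\<^sup>+x. ennreal ((cmod (f x + g x))\<^sup>2) \<partial>M)
    \<le> (\<integral>\<^sup>+x. 2 * ennreal ((cmod (f x))\<^sup>2) + 2 * ennreal ((cmod (g x))\<^sup>2) \<partial>M)"
  proof (rule nn_integral_mono)
    fix x
    show "ennreal ((cmod (f x + g x))\<^sup>2) \<le> 2 * ennreal ((cmod (f x))\<^sup>2) + 2 * ennreal ((cmod (g x))\<^sup>2)"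
      using ennreal_leI[OF power2_norm_add_le[of "f x" "g x"]]
      by (simp add: ennreal_plus ennreal_mult)
  qed
  then show ?thesis
    by (simp add: nn_integral_add nn_integral_cmult)
qed

text \<open>
  The triangle inequality for the \<open>L\<^sup>2\<close> distance, in the squared form
  \<open>\<bar>u + v\<bar>\<^sup>2 \<le> 2 \<bar>u\<bar>\<^sup>2 + 2 \<bar>v\<bar>\<^sup>2\<close>, shows that the closure is closed.
\<close>

lemma trig_approx_closed:
  assumes f[measurable]: "f \<in> borel_measurable (period_measure L)"
    and app: "\<And>\<epsilon>. 0 < \<epsilon> \<Longrightarrow> \<exists>h. trig_approx L h \<and> (\<integral>\<^sup>+x. ennreal ((cmod (f x - h x))\<^sup>2) \<partial>period_measure L) < ennreal \<epsilon>"
  shows "trig_approx L f"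
  unfolding trig_approx_def
proof (intro conjI f allI impI)
  fix \<epsilon> :: real assume \<epsilon>: "0 < \<epsilon>"
  then obtain h where h: "trig_approx L h" "(\<integral>\<^sup>+x. ennreal ((cmod (f x - h x))\<^sup>2) \<partial>period_measure L) < ennreal (\<epsilon>/4)"
    using app[of "\<epsilon>/4"] by auto
  then have [measurable]: "h \<in> borel_measurable (period_measure L)"
    by (simp add: trig_approx_def)
  obtain p where p: "trig_poly L p" "(\<integral>\<^sup>+x. ennreal ((cmod (h x - p x))\<^sup>2) \<partial>period_measure L) < ennreal (\<epsilon>/4)"
    using h(1) \<epsilon> unfolding trig_approx_def by (meson divide_pos_pos zero_less_numeral)
  have [measurable]: "p \<in> borel_measurable (period_measure L)"
    using p(1) by (rule trig_poly_measurable)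
  have "(\<integral>\<^sup>+x. ennreal ((cmod (f x - p x))\<^sup>2) \<partial>period_measure L)
      \<le> 2 * (\<integral>\<^sup>+x. ennreal ((cmod (f x - h x))\<^sup>2) \<partial>period_measure L) + 2 * (\<integral>\<^sup>+x. ennreal ((cmod (h x - p x))\<^sup>2) \<partial>period_measure L)"
    using nn_integral_square_add_le[of "\<lambda>x. f x - h x" "period_measure L" "\<lambda>x. h x - p x"] by simp
  also have "\<dots> < 2 * ennreal (\<epsilon>/4) + 2 * ennreal (\<epsilon>/4)"
    using h(2) p(2) by (intro add_strict_mono ennreal_mult_strict_left_mono) auto
  also have "\<dots> = ennreal \<epsilon>"
    using \<epsilon> by (simp flip: ennreal_plus ennreal_mult ennreal_numeral)
  finally show "\<exists>p. trig_poly L p \<and> (\<integral>\<^sup>+x. ennreal ((cmod (f x - p x))\<^sup>2) \<partial>period_measure L) < ennreal \<epsilon>"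
    using p(1) by blast
qed

lemma trig_poly_imp_approx: "trig_poly L p \<Longrightarrow> trig_approx L p"
  unfolding trig_approx_def using trig_poly_measurable
  by (intro conjI allI impI exI[of _ p]) auto

lemma trig_approx_add:
  assumes "trig_approx L f" "trig_approx L h"
  shows "trig_approx L (\<lambda>x. f x + h x)"
proof -
  have [measurable]: "f \<in> borel_measurable (period_measure L)" "h \<in> borel_measurable (period_measure L)"
    using assms by (auto simp: trig_approx_def)
  show ?thesis
  proof (rule trig_approx_closed)
    fix \<epsilon> :: real assume \<epsilon>: "0 < \<epsilon>"
    then have e4: "0 < \<epsilon>/4" by simp
    obtain p where p: "trig_poly L p" "(\<integral>\<^sup>+x. ennreal ((cmod (f x - p x))\<^sup>2) \<partial>period_measure L) < ennreal (\<epsilon>/4)"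
      using assms(1) e4 unfolding trig_approx_def by meson
    obtain q where q: "trig_poly L q" "(\<integral>\<^sup>+x. ennreal ((cmod (h x - q x))\<^sup>2) \<partial>period_measure L) < ennreal (\<epsilon>/4)"
      using assms(2) e4 unfolding trig_approx_def by meson
    note [measurable] = trig_poly_measurable[OF p(1)] trig_poly_measurable[OF q(1)]
    have "(\<integral>\<^sup>+x. ennreal ((cmod (f x + h x - (p x + q x)))\<^sup>2) \<partial>period_measure L)
      \<le> 2 * (\<integral>\<^sup>+x. ennreal ((cmod (f x - p x))\<^sup>2) \<partial>period_measure L) + 2 * (\<integral>\<^sup>+x. ennreal ((cmod (h x - q x))\<^sup>2) \<partial>period_measure L)"
      using nn_integral_square_add_le[of "\<lambda>x. f x - p x" "period_measure L" "\<lambda>x. h x - q x"]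
      by (simp add: algebra_simps)
    also have "\<dots> < 2 * ennreal (\<epsilon>/4) + 2 * ennreal (\<epsilon>/4)"
      using p(2) q(2) by (intro add_strict_mono ennreal_mult_strict_left_mono) auto
    also have "\<dots> = ennreal \<epsilon>"
      using \<epsilon> by (simp flip: ennreal_plus ennreal_mult ennreal_numeral)
    finally show "\<exists>r. trig_approx L r \<and> (\<integral>\<^sup>+x. ennreal ((cmod (f x + h x - r x))\<^sup>2) \<partial>period_measure L) < ennreal \<epsilon>"
      using trig_poly_imp_approx[OF trig_poly_add[OF p(1) q(1)]] by blast
  qed simp
qed

lemma trig_approx_cmult:
  assumes "trig_approx L f"
  shows "trig_approx L (\<lambda>x. c * f x)"
proof -
  have [measurable]: "f \<in> borel_measurable (period_measure L)"
    using assms by (auto simp: trig_approx_def)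
  show ?thesis
  proof (rule trig_approx_closed)
    fix \<epsilon> :: real assume \<epsilon>: "0 < \<epsilon>"
    define \<delta> where "\<delta> = \<epsilon> / ((cmod c)\<^sup>2 + 1)"
    have \<delta>: "0 < \<delta>" using \<epsilon> by (simp add: \<delta>_def add_nonneg_pos)
    obtain p where p: "trig_poly L p" "(\<integral>\<^sup>+x. ennreal ((cmod (f x - p x))\<^sup>2) \<partial>period_measure L) < ennreal \<delta>"
      using assms \<delta> unfolding trig_approx_def by meson
    note [measurable] = trig_poly_measurable[OF p(1)]
    have "(\<integral>\<^sup>+x. ennreal ((cmod (c * f x - c * p x))\<^sup>2) \<partial>period_measure L)
        = ennreal ((cmod c)\<^sup>2) * (\<integral>\<^sup>+x. ennreal ((cmod (f x - p x))\<^sup>2) \<partial>period_measure L)"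
      by (simp add: right_diff_distrib[symmetric] norm_mult power_mult_distrib ennreal_mult nn_integral_cmult)
    also have "\<dots> \<le> ennreal ((cmod c)\<^sup>2) * ennreal \<delta>"
      using p(2) by (intro mult_left_mono) auto
    also have "\<dots> < ennreal \<epsilon>"
    proof -
      have "(cmod c)\<^sup>2 * \<delta> < ((cmod c)\<^sup>2 + 1) * \<delta>"
        using \<delta> by simp
      also have "\<dots> = \<epsilon>"
        using add_nonneg_pos[of "(cmod c)\<^sup>2" 1] by (simp add: \<delta>_def)
      finally show ?thesis
        using \<epsilon> \<delta> by (simp flip: ennreal_mult add: ennreal_less_iff)
    qed
    finally show "\<exists>r. trig_approx L r \<and> (\<integral>\<^sup>+x. ennreal ((cmod (c * f x - r x))\<^sup>2) \<partial>period_measure L) < ennreal \<epsilon>"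
      using trig_poly_imp_approx[OF trig_poly_mult[OF trig_poly_const[of L c] p(1)]] by blast
  qed simp
qed

lemma trig_approx_sum:
  assumes "finite I" "\<And>i. i \<in> I \<Longrightarrow> trig_approx L (f i)"
  shows "trig_approx L (\<lambda>x. \<Sum>i\<in>I. f i x)"
  using assms
  by (induction I) (auto intro: trig_approx_add trig_poly_imp_approx[OF trig_poly_const])

lemma trig_approx_dominated_limit:
  assumes h: "\<And>i. trig_approx L (h i)" and f[measurable]: "f \<in> borel_measurable (period_measure L)"
    and w[measurable]: "w \<in> borel_measurable (period_measure L)" "(\<integral>\<^sup>+x. ennreal (w x) \<partial>period_measure L) < \<infinity>"
    and lim: "\<And>x. x \<in> {0..<L} \<Longrightarrow> (\<lambda>i. h i x) \<longlonglongrightarrow> f x"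
    and bound: "\<And>i x. x \<in> {0..<L} \<Longrightarrow> (cmod (f x - h i x))\<^sup>2 \<le> w x"
  shows "trig_approx L f"
proof (rule trig_approx_closed[OF f])
  fix \<epsilon> :: real assume \<epsilon>: "0 < \<epsilon>"
  have [measurable]: "h i \<in> borel_measurable (period_measure L)" for i
    using h by (auto simp: trig_approx_def)
  have "(\<lambda>i. \<integral>\<^sup>+x. ennreal ((cmod (f x - h i x))\<^sup>2) \<partial>period_measure L) \<longlonglongrightarrow> (\<integral>\<^sup>+x. 0 \<partial>period_measure L)"
  proof (rule nn_integral_dominated_convergence[where w = "\<lambda>x. ennreal (w x)"])
    show "AE x in period_measure L. (\<lambda>i. ennreal ((cmod (f x - h i x))\<^sup>2)) \<longlonglongrightarrow> 0"
    proof (rule AE_I2)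
      fix x assume "x \<in> space (period_measure L)"
      then have "(\<lambda>i. h i x) \<longlonglongrightarrow> f x"
        using lim by simp
      then have "(\<lambda>i. ennreal ((cmod (f x - h i x))\<^sup>2)) \<longlonglongrightarrow> ennreal ((cmod (f x - f x))\<^sup>2)"
        by (intro tendsto_intros)
      then show "(\<lambda>i. ennreal ((cmod (f x - h i x))\<^sup>2)) \<longlonglongrightarrow> 0"
        by simp
    qed
  qed (use w bound in \<open>auto intro!: AE_I2 ennreal_leI\<close>)
  then have "\<forall>\<^sub>F i in sequentially. (\<integral>\<^sup>+x. ennreal ((cmod (f x - h i x))\<^sup>2) \<partial>period_measure L) < ennreal \<epsilon>"
    using \<epsilon> by (intro order_tendstoD) auto
  then show "\<exists>h. trig_approx L h \<and> (\<integral>\<^sup>+x. ennreal ((cmod (f x - h x))\<^sup>2) \<partial>period_measure L) < ennreal \<epsilon>"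
    using h by (auto simp: eventually_sequentially)
qed

text \<open>
  A function on the period that factors continuously through the unit circle is a uniform limit of
  trigonometric polynomials, hence an \<open>L\<^sup>2\<close> limit since the period has finite measure.
\<close>

lemma trig_approx_continuous:
  fixes h :: "complex \<Rightarrow> real"
  assumes L: "0 < L" and h: "continuous_on (sphere 0 1) h"
  shows "trig_approx L (\<lambda>x. of_real (h (trig_mono L 1 x)))"
proof (rule trig_approx_closed)
  have "continuous_on {0..<L} (\<lambda>x. of_real (h (trig_mono L 1 x)) :: complex)"
    by (intro continuous_intros continuous_on_compose2[OF h continuous_trig_mono]) auto
  then show "(\<lambda>x. of_real (h (trig_mono L 1 x)) :: complex) \<in> borel_measurable (period_measure L)"
    by (rule continuous_imp_measurable_on_sets_lebesgue) simp
  fix \<epsilon> :: real assume \<epsilon>: "0 < \<epsilon>"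
  define \<delta> where "\<delta> = sqrt (\<epsilon> / (2 * L))"
  have \<delta>: "0 < \<delta>" "\<delta>\<^sup>2 * L < \<epsilon>" using \<epsilon> L by (auto simp: \<delta>_def)
  obtain p where p: "real_polynomial_function p" "\<And>z. z \<in> sphere 0 1 \<Longrightarrow> \<bar>h z - p z\<bar> < \<delta>"
    using Stone_Weierstrass_real_polynomial_function[OF compact_sphere h \<delta>(1)] by blast
  have "(\<integral>\<^sup>+x. ennreal ((cmod (of_real (h (trig_mono L 1 x)) - of_real (p (trig_mono L 1 x))))\<^sup>2) \<partial>period_measure L)
     \<le> (\<integral>\<^sup>+x. ennreal (\<delta>\<^sup>2) \<partial>period_measure L)"
  proof (intro nn_integral_mono ennreal_leI)
    fix x
    have "\<bar>h (trig_mono L 1 x) - p (trig_mono L 1 x)\<bar> \<le> \<bar>\<delta>\<bar>"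
      using p(2)[of "trig_mono L 1 x"] by simp
    then show "(cmod (of_real (h (trig_mono L 1 x)) - of_real (p (trig_mono L 1 x))))\<^sup>2 \<le> \<delta>\<^sup>2"
      by (metis norm_of_real of_real_diff abs_le_square_iff power2_abs)
  qed
  also have "\<dots> = ennreal (\<delta>\<^sup>2 * L)"
    using L by (simp add: emeasure_restrict_space ennreal_mult)
  also have "\<dots> < ennreal \<epsilon>"
    using \<delta>(2) \<epsilon> by (simp add: ennreal_less_iff L less_imp_le)
  finally show "\<exists>r. trig_approx L r \<and> (\<integral>\<^sup>+x. ennreal ((cmod (of_real (h (trig_mono L 1 x)) - r x))\<^sup>2) \<partial>period_measure L) < ennreal \<epsilon>"
    using trig_poly_imp_approx[OF trig_poly_real_polynomial[OF p(1)]] by blast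
qed

lemma trig_mono_inj:
  assumes "0 < L" "x \<in> {0..<L}" "y \<in> {0..<L}" "trig_mono L 1 x = trig_mono L 1 y"
  shows "x = y"
proof -
  have "cis (2 * pi * x / L) = cis (2 * pi * y / L)"
    using assms(4) by (simp add: trig_mono_def)
  moreover have "2 * pi * x / L \<in> {0..<2*pi}" "2 * pi * y / L \<in> {0..<2*pi}"
    using assms by (auto simp: field_simps)
  ultimately have "2 * pi * x / L = 2 * pi * y / L"
    by (metis Arg2pi_unique[of 1] atLeastLessThan_iff cis_conv_exp mult_1 of_real_1 zero_less_one)
  then show ?thesis using assms(1) by simp
qed

text \<open>
  The image \<open>K\<close> of a closed set \<open>T\<close> on the circle is compact, and the tent functions
  \<open>max 0 (1 - i * infdist z K)\<close> are continuous and decrease to the indicator of \<open>K\<close>. Since the period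
  maps injectively to the circle, pulling back gives exactly the indicator of \<open>T\<close>, even if \<open>T\<close>
  contains \<open>0\<close>.
\<close>

lemma trig_approx_indicator_closed:
  assumes L: "0 < L" and T: "closed T" "T \<subseteq> {0..<L}"
  shows "trig_approx L (indicator T)"
proof (cases "T = {}")
  case True
  then show ?thesis
    using trig_poly_imp_approx[OF trig_poly_const[of L 0]] by (simp add: indicator_def[abs_def])
next
  case False
  define K where "K = trig_mono L 1 ` T"
  have "compact T"
  proof -
    have "{0..L} \<inter> T = T" using T(2) by auto
    then show ?thesis using compact_Int_closed[OF compact_Icc T(1), of 0 L] by simp
  qed
  then have K: "closed K" "K \<noteq> {}"
    using False by (auto simp: K_def intro!: compact_imp_closed compact_continuous_image continuous_trig_mono)
  define h where "h i z = max 0 (1 - real i * infdist z K)" for i z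
  show ?thesis
  proof (rule trig_approx_dominated_limit)
    show "trig_approx L (\<lambda>x. of_real (h i (trig_mono L 1 x)))" for i
      unfolding h_def by (intro trig_approx_continuous L continuous_intros)
    show "(\<integral>\<^sup>+x. ennreal 1 \<partial>period_measure L) < \<infinity>"
      using L by (simp add: emeasure_restrict_space)
    have "T \<in> sets lebesgue" using T(1) by (simp add: borel_closed)
    then show "(indicator T :: real \<Rightarrow> complex) \<in> borel_measurable (period_measure L)"
      by (auto intro!: measurable_restrict_space1)
    fix x assume x: "x \<in> {0..<L}"
    have iff: "trig_mono L 1 x \<in> K \<longleftrightarrow> x \<in> T"
      using trig_mono_inj[OF L x] T(2) by (auto simp: K_def)
    have hb: "0 \<le> h i z" "h i z \<le> 1" for i z
      using infdist_nonneg[of z K] by (auto simp: h_def)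
    show "(cmod (indicator T x - of_real (h i (trig_mono L 1 x))))\<^sup>2 \<le> 1" for i
    proof -
      have "indicator T x - of_real (h i (trig_mono L 1 x)) = (of_real (indicator T x - h i (trig_mono L 1 x)) :: complex)"
        by (simp add: indicator_def)
      moreover have "\<bar>indicator T x - h i (trig_mono L 1 x)\<bar> \<le> 1"
        using hb[of i "trig_mono L 1 x"] by (auto simp: indicator_def)
      ultimately show ?thesis
        by (metis norm_of_real abs_square_le_1 abs_norm_cancel)
    qed
    have "(\<lambda>i. h i (trig_mono L 1 x)) \<longlonglongrightarrow> indicator T x"
    proof (cases "x \<in> T")
      case True
      then show ?thesis using iff K by (simp add: h_def)
    next
      case False
      then have d: "0 < infdist (trig_mono L 1 x) K"
        using iff K infdist_pos_not_in_closed by metis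
      obtain N :: nat where N: "1 / infdist (trig_mono L 1 x) K < real N"
        using reals_Archimedean2 by blast
      have "h i (trig_mono L 1 x) = 0" if "N \<le> i" for i
      proof -
        have "1 < real N * infdist (trig_mono L 1 x) K"
          using N d by (simp add: field_simps)
        also have "\<dots> \<le> real i * infdist (trig_mono L 1 x) K"
          using that d by (intro mult_right_mono) auto
        finally show ?thesis by (simp add: h_def)
      qed
      then have "\<forall>\<^sub>F i in sequentially. h i (trig_mono L 1 x) = 0"
        by (auto simp: eventually_sequentially)
      then show ?thesis using False by (simp add: tendsto_eventually)
    qed
    then have "(\<lambda>i. of_real (h i (trig_mono L 1 x)) :: complex) \<longlonglongrightarrow> of_real (indicator T x)"
      by (rule tendsto_of_real)
    also have "of_real (indicator T x) = (indicator T x :: complex)"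
      by (simp add: indicator_def)
    finally show "(\<lambda>i. of_real (h i (trig_mono L 1 x)) :: complex) \<longlonglongrightarrow> indicator T x" .
  qed auto
qed

text \<open>
  Inner regularity of Lebesgue measure: a measurable set differs from some closed subset by a set of
  small measure, and that measure is the squared \<open>L\<^sup>2\<close> distance of the indicators.
\<close>

lemma trig_approx_indicator:
  assumes L: "0 < L" and S: "S \<in> sets (period_measure L)"
  shows "trig_approx L (indicator S)"
proof (rule trig_approx_closed)
  show "indicator S \<in> borel_measurable (period_measure L)"
    using S by simp
  fix \<epsilon> :: real assume \<epsilon>: "0 < \<epsilon>"
  have S': "S \<in> sets lebesgue" "S \<subseteq> {0..<L}"
    using S by (auto simp: sets_restrict_space_iff)
  obtain T where T: "closed T" "T \<subseteq> S" "S - T \<in> lmeasurable" "emeasure lebesgue (S - T) < ennreal \<epsilon>"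
    using sets_lebesgue_inner_closed[OF S'(1) \<epsilon>] by blast
  have "(\<integral>\<^sup>+x. ennreal ((cmod (indicator S x - indicator T x))\<^sup>2) \<partial>period_measure L)
      = (\<integral>\<^sup>+x. indicator (S - T) x \<partial>period_measure L)"
    using T(2) by (intro nn_integral_cong) (auto simp: indicator_def)
  also have "\<dots> = emeasure (period_measure L) (S - T)"
    using S' T by (intro nn_integral_indicator) (auto simp: sets_restrict_space_iff)
  also have "\<dots> = emeasure lebesgue (S - T)"
    using S' by (intro emeasure_restrict_space) auto
  also have "\<dots> < ennreal \<epsilon>" by (rule T(4))
  finally show "\<exists>h. trig_approx L h \<and> (\<integral>\<^sup>+x. ennreal ((cmod (indicator S x - h x))\<^sup>2) \<partial>period_measure L) < ennreal \<epsilon>"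
    using trig_approx_indicator_closed[OF L T(1)] T(2) S'(2) by blast
qed

text \<open>
  Completeness of the trigonometric system: indicators give simple functions by linearity, and simple
  functions approximate every square integrable function by dominated convergence.
\<close>

lemma trig_approx_L2:
  assumes L: "0 < L" and f[measurable]: "f \<in> borel_measurable (period_measure L)"
    and fin: "(\<integral>\<^sup>+x. ennreal ((cmod (f x))\<^sup>2) \<partial>period_measure L) < \<infinity>"
  shows "trig_approx L f"
proof -
  obtain s where s: "\<And>i. simple_function (period_measure L) (s i)"
    "\<And>x. x \<in> {0..<L} \<Longrightarrow> (\<lambda>i. s i x) \<longlonglongrightarrow> f x"
    "\<And>i x. x \<in> {0..<L} \<Longrightarrow> cmod (s i x) \<le> 2 * cmod (f x)"
    using borel_measurable_implies_sequence_metric[OF f, of 0] that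
    unfolding dist_0_norm dist_norm diff_zero space_lebesgue_on by metis
  \<comment> \<open>\<open>\<bar>s i x\<bar> \<le> 2 \<bar>f x\<bar>\<close> gives \<open>\<bar>f x - s i x\<bar> \<le> 3 \<bar>f x\<bar>\<close>, whence the dominating function.\<close>
  show ?thesis
  proof (rule trig_approx_dominated_limit[OF _ f _ _ s(2), where w = "\<lambda>x. 9 * (cmod (f x))\<^sup>2"])
    fix i
    define Y where "Y = s i ` {0..<L}"
    have "finite Y"
      using s(1)[of i] by (simp add: simple_function_def Y_def)
    moreover have "s i -` {y} \<inter> {0..<L} \<in> sets (period_measure L)" for y
      using simple_functionD(2)[OF s(1)[of i], of "{y}"] by simp
    ultimately have "trig_approx L (\<lambda>x. \<Sum>y\<in>Y. y * indicator (s i -` {y} \<inter> {0..<L}) x)"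
      by (intro trig_approx_sum trig_approx_cmult trig_approx_indicator L)
    moreover have "(\<Sum>y\<in>Y. y * indicator (s i -` {y} \<inter> {0..<L}) x) = s i x" if "x \<in> {0..<L}" for x
    proof -
      have "(\<Sum>y\<in>Y. y * indicator (s i -` {y} \<inter> {0..<L}) x) = (\<Sum>y\<in>Y. if y = s i x then y else 0)"
        using that by (intro sum.cong) (auto simp: indicator_def)
      also have "\<dots> = s i x"
        using that \<open>finite Y\<close> by (simp add: Y_def)
      finally show ?thesis .
    qed
    ultimately show "trig_approx L (s i)"
      using borel_measurable_simple_function[OF s(1)[of i]] unfolding trig_approx_def
      by (simp cong: nn_integral_cong_simp)
  next
    show "(\<integral>\<^sup>+x. ennreal (9 * (cmod (f x))\<^sup>2) \<partial>period_measure L) < \<infinity>"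
      using fin by (simp add: ennreal_mult nn_integral_cmult ennreal_mult_less_top)
    fix i x assume x: "x \<in> {0..<L}"
    have "cmod (f x - s i x) \<le> 3 * cmod (f x)"
      using s(3)[OF x, of i] norm_triangle_ineq4[of "f x" "s i x"] by simp
    then have "(cmod (f x - s i x))\<^sup>2 \<le> (3 * cmod (f x))\<^sup>2"
      by (intro power_mono) auto
    then show "(cmod (f x - s i x))\<^sup>2 \<le> 9 * (cmod (f x))\<^sup>2"
      by (simp add: power_mult_distrib)
  qed auto
qed


lemma borel_measurable_cnj' [measurable]: "cnj \<in> borel_measurable borel"
  by (intro borel_measurable_continuous_onI continuous_intros)

lemma integrable_mult_cnj:
  assumes [measurable]: "f \<in> borel_measurable M" "h \<in> borel_measurable M"
    and "integrable M (\<lambda>x. (cmod (f x))\<^sup>2)" "integrable M (\<lambda>x. (cmod (h x))\<^sup>2)"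
  shows "integrable M (\<lambda>x. f x * cnj (h x))"
proof (rule Bochner_Integration.integrable_bound)
  show "integrable M (\<lambda>x. (cmod (f x))\<^sup>2 + (cmod (h x))\<^sup>2)"
    using assms by simp
  show "AE x in M. norm (f x * cnj (h x)) \<le> norm ((cmod (f x))\<^sup>2 + (cmod (h x))\<^sup>2)"
  proof (rule AE_I2)
    fix x
    have "cmod (f x) * cmod (h x) \<le> (cmod (f x))\<^sup>2 + (cmod (h x))\<^sup>2"
      using sum_squares_bound[of "cmod (f x)" "cmod (h x)"]
        mult_nonneg_nonneg[OF norm_ge_zero[of "f x"] norm_ge_zero[of "h x"]] by linarith
    then show "norm (f x * cnj (h x)) \<le> norm ((cmod (f x))\<^sup>2 + (cmod (h x))\<^sup>2)"
      by (simp add: norm_mult)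
  qed
qed simp

text \<open>
  Expanding the square and completing it in the coefficients \<open>d m\<close>. The right-hand side is smallest
  for \<open>d m = c m / L\<close>, which yields Bessel's inequality; for arbitrary \<open>d\<close> it bounds the defect in
  Bessel's inequality by the distance from \<open>f\<close> to a given trigonometric polynomial.
\<close>

lemma trig_poly_distance:
  fixes c d :: "int \<Rightarrow> complex"
  assumes L: "0 < L" and f[measurable]: "f \<in> borel_measurable (period_measure L)"
    and f2: "integrable (period_measure L) (\<lambda>x. (cmod (f x))\<^sup>2)" and S: "finite S"
    and c: "\<And>m. c m = (LINT x|period_measure L. f x * cnj (trig_mono L m x))"
  defines "p \<equiv> \<lambda>x. \<Sum>m\<in>S. d m * trig_mono L m x"
  shows "integrable (period_measure L) (\<lambda>x. (cmod (f x - p x))\<^sup>2)"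
    and "(LINT x|period_measure L. (cmod (f x - p x))\<^sup>2)
      = (LINT x|period_measure L. (cmod (f x))\<^sup>2) - (\<Sum>m\<in>S. (cmod (c m))\<^sup>2) / L
        + L * (\<Sum>m\<in>S. (cmod (d m - c m / L))\<^sup>2)"
proof -
  let ?M = "period_measure L"
  have e2: "integrable ?M (\<lambda>x. (cmod (trig_mono L m x))\<^sup>2)" for m
    using finite_measure.integrable_const[OF finite_measure_period, of L "1::real"] by simp
  have fe: "integrable ?M (\<lambda>x. f x * cnj (trig_mono L m x))" for m
    using f2 e2 by (intro integrable_mult_cnj) auto
  have ee: "integrable ?M (\<lambda>x. trig_mono L m x * cnj (trig_mono L n x))" for m n
    using e2 by (intro integrable_mult_cnj) auto
  have fp: "has_bochner_integral ?M (\<lambda>x. f x * cnj (p x)) (\<Sum>m\<in>S. cnj (d m) * c m)"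
  proof -
    have "f x * cnj (p x) = (\<Sum>m\<in>S. cnj (d m) * (f x * cnj (trig_mono L m x)))" for x
      by (simp add: p_def sum_distrib_left mult_ac)
    then show ?thesis
      using fe by (auto simp: c intro!: has_bochner_integral_sum has_bochner_integral_mult_right
          has_bochner_integral_integrable)
  qed
  have pp: "has_bochner_integral ?M (\<lambda>x. p x * cnj (p x)) (\<Sum>m\<in>S. \<Sum>n\<in>S. (d m * cnj (d n)) * (if m = n then of_real L else 0))"
  proof -
    have "p x * cnj (p x) = (\<Sum>m\<in>S. \<Sum>n\<in>S. (d m * cnj (d n)) * (trig_mono L m x * cnj (trig_mono L n x)))" for x
      by (simp add: p_def sum_product mult_ac)
    moreover have "has_bochner_integral ?M (\<lambda>x. trig_mono L m x * cnj (trig_mono L n x)) (if m = n then of_real L else 0)" for m n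
      using ee[of m n] integral_trig_mono_cnj[OF L, of m n] by (simp only: has_bochner_integral_iff simp_thms)
    ultimately show ?thesis
      by (simp only:) (intro has_bochner_integral_sum has_bochner_integral_mult_right)
  qed
  have "(\<Sum>m\<in>S. \<Sum>n\<in>S. (d m * cnj (d n)) * (if m = n then of_real L else 0)) = of_real (\<Sum>m\<in>S. L * (cmod (d m))\<^sup>2)"
    using S by (simp add: if_distrib[of "\<lambda>u. _ * u"] complex_norm_square mult_ac del: of_real_power cong: if_cong)
  with pp have pp': "has_bochner_integral ?M (\<lambda>x. Re (p x * cnj (p x))) (\<Sum>m\<in>S. L * (cmod (d m))\<^sup>2)"
    using has_bochner_integral_Re[OF pp] by simp
  have "has_bochner_integral ?M (\<lambda>x. (cmod (f x))\<^sup>2 - 2 * Re (f x * cnj (p x)) + Re (p x * cnj (p x)))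
      ((LINT x|?M. (cmod (f x))\<^sup>2) - 2 * Re (\<Sum>m\<in>S. cnj (d m) * c m) + (\<Sum>m\<in>S. L * (cmod (d m))\<^sup>2))"
    by (intro has_bochner_integral_add has_bochner_integral_diff has_bochner_integral_mult_right pp'
        has_bochner_integral_Re fp has_bochner_integral_integrable f2)
  moreover have "(cmod (f x))\<^sup>2 - 2 * Re (f x * cnj (p x)) + Re (p x * cnj (p x)) = (cmod (f x - p x))\<^sup>2" for x
    by (simp only: cmod_power2) (simp add: power2_eq_square algebra_simps)
  moreover have "(LINT x|?M. (cmod (f x))\<^sup>2) - 2 * Re (\<Sum>m\<in>S. cnj (d m) * c m) + (\<Sum>m\<in>S. L * (cmod (d m))\<^sup>2)
     = (LINT x|?M. (cmod (f x))\<^sup>2) - (\<Sum>m\<in>S. (cmod (c m))\<^sup>2) / L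
        + L * (\<Sum>m\<in>S. (cmod (d m - c m / L))\<^sup>2)"
  proof -
    have "L * (cmod (d m))\<^sup>2 - 2 * Re (cnj (d m) * c m) = L * (cmod (d m - c m / L))\<^sup>2 - (cmod (c m))\<^sup>2 / L" for m
      using L by (simp only: cmod_power2) (simp add: power2_eq_square field_simps)
    then have "(\<Sum>m\<in>S. L * (cmod (d m))\<^sup>2 - 2 * Re (cnj (d m) * c m))
      = (\<Sum>m\<in>S. L * (cmod (d m - c m / L))\<^sup>2 - (cmod (c m))\<^sup>2 / L)"
      by (rule sum.cong[OF refl])
    then show ?thesis
      by (simp add: sum_subtractf sum_distrib_left sum_divide_distrib)
  qed
  ultimately have "has_bochner_integral ?M (\<lambda>x. (cmod (f x - p x))\<^sup>2) ((LINT x|?M. (cmod (f x))\<^sup>2) - (\<Sum>m\<in>S. (cmod (c m))\<^sup>2) / L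
        + L * (\<Sum>m\<in>S. (cmod (d m - c m / L))\<^sup>2))"
    by (simp only:)
  then show "integrable ?M (\<lambda>x. (cmod (f x - p x))\<^sup>2)"
    "(LINT x|?M. (cmod (f x - p x))\<^sup>2)
      = (LINT x|?M. (cmod (f x))\<^sup>2) - (\<Sum>m\<in>S. (cmod (c m))\<^sup>2) / L
        + L * (\<Sum>m\<in>S. (cmod (d m - c m / L))\<^sup>2)"
    by (auto simp: has_bochner_integral_iff)
qed

text \<open>
  Bessel's inequality bounds all finite partial sums from above. If a trigonometric polynomial with
  frequencies in \<open>S\<close> is close to \<open>f\<close>, then the partial sum over any \<open>T \<supseteq> S\<close> is close to the bound.
  The coefficients are not normalised, so the factor \<open>L\<close> appears on the right.
\<close>

lemma parseval:
  assumes L: "0 < L" and f[measurable]: "f \<in> borel_measurable (period_measure L)"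
    and f2: "integrable (period_measure L) (\<lambda>x. (cmod (f x))\<^sup>2)"
  shows "((\<lambda>m. (cmod (LINT x|period_measure L. f x * cnj (trig_mono L m x)))\<^sup>2) has_sum
    (L * (LINT x|period_measure L. (cmod (f x))\<^sup>2))) UNIV"
proof -
  let ?M = "period_measure L"
  define c where "c m = (LINT x|?M. f x * cnj (trig_mono L m x))" for m
  define I where "I = (LINT x|?M. (cmod (f x))\<^sup>2)"
  note dist = trig_poly_distance[OF L f f2 _ c_def, folded I_def]
  have bessel: "(\<Sum>m\<in>S. (cmod (c m))\<^sup>2) \<le> L * I" if "finite S" for S
  proof -
    have "0 \<le> (LINT x|?M. (cmod (f x - (\<Sum>m\<in>S. (c m / L) * trig_mono L m x)))\<^sup>2)"
      by simp
    then have "0 \<le> I - (\<Sum>m\<in>S. (cmod (c m))\<^sup>2) / L"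
      unfolding dist(2)[OF that] by simp
    then show ?thesis using L by (simp add: field_simps)
  qed
  have "((\<lambda>m. (cmod (c m))\<^sup>2) has_sum (L * I)) UNIV"
    unfolding has_sum_def
  proof (rule order_tendstoI)
    fix y assume y: "y < L * I"
    define \<epsilon> where "\<epsilon> = I - y / L"
    have \<epsilon>: "0 < \<epsilon>" using y L by (simp add: \<epsilon>_def field_simps)
    have "(\<integral>\<^sup>+x. ennreal ((cmod (f x))\<^sup>2) \<partial>?M) < \<infinity>"
      using f2 by (simp add: nn_integral_eq_integral)
    then obtain p where p: "trig_poly L p" "(\<integral>\<^sup>+x. ennreal ((cmod (f x - p x))\<^sup>2) \<partial>?M) < ennreal \<epsilon>"
      using trig_approx_L2[OF L f] \<epsilon> unfolding trig_approx_def by meson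
    obtain S d where S: "finite S" "\<And>T. finite T \<Longrightarrow> S \<subseteq> T \<Longrightarrow> p = (\<lambda>x. \<Sum>m\<in>T. d m * trig_mono L m x)"
      using p(1) by (rule trig_polyE_superset) blast
    have "y < (\<Sum>m\<in>T. (cmod (c m))\<^sup>2)" if T: "finite T" "S \<subseteq> T" for T
    proof -
      have pT: "p = (\<lambda>x. \<Sum>m\<in>T. d m * trig_mono L m x)"
        using S(2) T by blast
      have "(LINT x|?M. (cmod (f x - p x))\<^sup>2) < \<epsilon>"
        using p(2) dist(1)[OF T(1), of d] \<epsilon> unfolding pT
        by (simp add: nn_integral_eq_integral ennreal_less_iff)
      then have "I - (\<Sum>m\<in>T. (cmod (c m))\<^sup>2) / L + L * (\<Sum>m\<in>T. (cmod (d m - c m / L))\<^sup>2) < \<epsilon>"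
        using dist(2)[OF T(1), of d] unfolding pT by simp
      moreover have "0 \<le> L * (\<Sum>m\<in>T. (cmod (d m - c m / L))\<^sup>2)"
        using L by (simp add: sum_nonneg)
      ultimately have "y / L < (\<Sum>m\<in>T. (cmod (c m))\<^sup>2) / L"
        by (simp add: \<epsilon>_def)
      then show ?thesis using L by (simp add: divide_less_cancel)
    qed
    then show "\<forall>\<^sub>F T in finite_subsets_at_top UNIV. y < (\<Sum>m\<in>T. (cmod (c m))\<^sup>2)"
      using S(1) by (auto simp: eventually_finite_subsets_at_top)
  next
    fix y assume "L * I < y"
    then have "(\<Sum>m\<in>T. (cmod (c m))\<^sup>2) < y" if "finite T" for T
      using bessel[OF that] by simp
    then show "\<forall>\<^sub>F T in finite_subsets_at_top UNIV. (\<Sum>m\<in>T. (cmod (c m))\<^sup>2) < y"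
      by (auto simp: eventually_finite_subsets_at_top)
  qed
  then show ?thesis by (simp add: c_def I_def)
qed

section \<open>Periodization\<close>

text \<open>
  Sums over a countable type are integrals for the counting measure. This brings the interchange
  theorems for integrals to bear on \<open>infsum\<close>.
\<close>

lemma infsum_ennreal_eq_nn_integral:
  fixes f :: "'i::countable \<Rightarrow> ennreal"
  shows "(\<Sum>\<^sub>\<infinity>i. f i) = (\<integral>\<^sup>+i. f i \<partial>count_space UNIV)"
proof (rule antisym)
  have "(\<Sum>\<^sub>\<infinity>i. f i) = (SUP F\<in>{F. finite F \<and> F \<subseteq> UNIV}. sum f F)"
    by (rule nonneg_infsum_complete) simp
  then have inf: "(\<Sum>\<^sub>\<infinity>i. f i) = (SUP F\<in>{F. finite F}. sum f F)"
    by simp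
  show "(\<Sum>\<^sub>\<infinity>i. f i) \<le> (\<integral>\<^sup>+i. f i \<partial>count_space UNIV)"
    unfolding inf
  proof (rule SUP_least)
    fix F :: "'i set" assume "F \<in> {F. finite F}"
    then have "sum f F = (\<integral>\<^sup>+i. f i * indicator F i \<partial>count_space UNIV)"
      by (subst nn_integral_count_space'[of F]) (auto simp: indicator_def)
    also have "\<dots> \<le> (\<integral>\<^sup>+i. f i \<partial>count_space UNIV)"
      by (intro nn_integral_mono) (auto simp: indicator_def)
    finally show "sum f F \<le> (\<integral>\<^sup>+i. f i \<partial>count_space UNIV)" .
  qed
  define E where "E n = {i::'i. to_nat i < n}" for n
  have E: "finite (E n)" for n
    using finite_imageD[of to_nat "E n"] finite_subset[of "to_nat ` E n" "{..<n}"]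
    by (auto simp: E_def inj_on_def)
  have "(\<integral>\<^sup>+i. f i \<partial>count_space UNIV) = (\<integral>\<^sup>+i. (SUP n. f i * indicator (E n) i) \<partial>count_space UNIV)"
  proof (rule nn_integral_cong)
    fix i :: 'i
    show "f i = (SUP n. f i * indicator (E n) i)"
    proof (rule antisym)
      have "i \<in> E (Suc (to_nat i))" by (simp add: E_def)
      then show "f i \<le> (SUP n. f i * indicator (E n) i)"
        by (intro SUP_upper2[of "Suc (to_nat i)"]) auto
    qed (auto intro!: SUP_least simp: indicator_def)
  qed
  also have "\<dots> = (SUP n. \<integral>\<^sup>+i. f i * indicator (E n) i \<partial>count_space UNIV)"
    by (intro nn_integral_monotone_convergence_SUP) (auto simp: incseq_def le_fun_def E_def indicator_def)
  also have "\<dots> = (SUP n. sum f (E n))"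
  proof -
    have "(\<integral>\<^sup>+i. f i * indicator (E n) i \<partial>count_space UNIV) = sum f (E n)" for n
      using E[of n] by (subst nn_integral_count_space'[of "E n"]) (auto simp: indicator_def)
    then show ?thesis by simp
  qed
  also have "\<dots> \<le> (\<Sum>\<^sub>\<infinity>i. f i)"
    unfolding inf using E by (intro SUP_least SUP_upper) auto
  finally show "(\<integral>\<^sup>+i. f i \<partial>count_space UNIV) \<le> (\<Sum>\<^sub>\<infinity>i. f i)" .
qed

text \<open>
  No summability is assumed: for complex families, convergence and absolute convergence coincide, and
  both sides are \<open>0\<close> by convention when they fail. In particular, the right-hand side shows that
  \<open>infsum\<close> depends measurably on parameters.
\<close>

lemma infsum_complex_eq_integral:
  fixes f :: "'i \<Rightarrow> complex"
  shows "(\<Sum>\<^sub>\<infinity>i. f i) = (LINT i|count_space UNIV. f i)"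
proof (cases "f summable_on UNIV")
  case True
  then have "Infinite_Sum.abs_summable_on f UNIV"
    by (simp add: summable_on_iff_abs_summable_on_complex)
  then show ?thesis
    using infsetsum_infsum[of f UNIV] abs_summable_equivalent[of f UNIV] by (simp add: infsetsum_def)
next
  case False
  then have "\<not> integrable (count_space UNIV) f"
    using abs_summable_equivalent[of f UNIV]
    by (simp add: Infinite_Set_Sum.abs_summable_on_def summable_on_iff_abs_summable_on_complex)
  then show ?thesis
    using False by (simp add: infsum_not_exists not_integrable_integral_eq)
qed

lemma lebesgue_shift_measurable [measurable]: "(\<lambda>x::real. x + c) \<in> lebesgue \<rightarrow>\<^sub>M lebesgue"
  using lebesgue_affine_measurable[of "\<lambda>_. 1::real" c] by (simp add: add.commute)

lemma nn_integral_lebesgue_shift: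
  fixes f :: "real \<Rightarrow> ennreal"
  assumes "f \<in> borel_measurable lebesgue"
  shows "(\<integral>\<^sup>+x. f (x + c) \<partial>lebesgue) = (\<integral>\<^sup>+x. f x \<partial>lebesgue)"
  using nn_integral_real_affine_lebesgue[OF assms, of 1 c] by (simp add: add.commute)

lemma ex_period_shift:
  fixes L x :: real
  assumes "0 < L"
  shows "\<exists>!k::int. x - of_int k * L \<in> {0..<L}"
proof (rule ex1I[of _ "\<lfloor>x / L\<rfloor>"])
  have "of_int \<lfloor>x / L\<rfloor> * L \<le> x / L * L" "x / L * L < (of_int \<lfloor>x / L\<rfloor> + 1) * L"
    using assms by (intro mult_right_mono mult_strict_right_mono; linarith)+
  then show "x - of_int \<lfloor>x / L\<rfloor> * L \<in> {0..<L}"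
    using assms by (simp add: algebra_simps)
  fix k :: int assume "x - of_int k * L \<in> {0..<L}"
  then show "k = \<lfloor>x / L\<rfloor>"
    using assms by (intro floor_unique[symmetric]) (auto simp: field_simps)
qed

lemma nn_integral_period_indicator:
  fixes L x :: real
  assumes "0 < L"
  shows "(\<integral>\<^sup>+k. indicator {0..<L} (x - of_int k * L) \<partial>count_space UNIV) = (1::ennreal)"
proof -
  obtain k0 :: int where k0: "x - of_int k0 * L \<in> {0..<L}" "\<And>k::int. x - of_int k * L \<in> {0..<L} \<Longrightarrow> k = k0"
    using ex_period_shift[OF assms, of x] by (rule ex1E) blast
  have "(\<integral>\<^sup>+k. indicator {0..<L} (x - of_int k * L) \<partial>count_space UNIV) = (\<Sum>k\<in>{k0}. indicator {0..<L} (x - of_int k * L) :: ennreal)"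
  proof (rule nn_integral_count_space')
    fix k :: int assume "k \<notin> {k0}"
    then have "x - of_int k * L \<notin> {0..<L}" using k0(2)[of k] by blast
    then show "indicator {0..<L} (x - of_int k * L) = (0::ennreal)" by (rule indicator_simps)
  qed auto
  then show ?thesis using k0(1) by simp
qed

abbreviation tiling_measure :: "real \<Rightarrow> (real \<times> int) measure" where
  "tiling_measure L \<equiv> period_measure L \<Otimes>\<^sub>M count_space UNIV"

lemma sigma_finite_period: "sigma_finite_measure (period_measure L)"
  by (intro finite_measure.axioms(1) finite_measure_period)

lemma pair_sigma_finite_period: "pair_sigma_finite (period_measure L) (count_space (UNIV::int set))"
  by (intro pair_sigma_finite.intro sigma_finite_period sigma_finite_measure_count_space)

lemma tiling_map_measurable [measurable]:
  "(\<lambda>(x, k). x + of_int k * L) \<in> tiling_measure L \<rightarrow>\<^sub>M lebesgue"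
proof -
  have "(\<lambda>x. x + of_int k * L) \<in> period_measure L \<rightarrow>\<^sub>M lebesgue" for k
    by (rule measurable_restrict_space1[OF lebesgue_shift_measurable])
  then have "(\<lambda>p. fst p + of_int k * L) \<in> tiling_measure L \<rightarrow>\<^sub>M lebesgue" for k
    by (rule measurable_compose[OF measurable_fst])
  from measurable_compose_countable[OF this measurable_snd]
  show ?thesis by (simp add: case_prod_beta)
qed

text \<open>
  The line is the disjoint union of the translates of one period, and Lebesgue measure is invariant
  under translation.
\<close>

lemma nn_integral_tiling:
  fixes f :: "real \<Rightarrow> ennreal"
  assumes L: "0 < L" and f[measurable]: "f \<in> borel_measurable lebesgue"
  shows "(\<integral>\<^sup>+x. (\<integral>\<^sup>+k. f (x + of_int k * L) \<partial>count_space (UNIV::int set)) \<partial>period_measure L)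
    = (\<integral>\<^sup>+x. f x \<partial>lebesgue)"
proof -
  have shift[measurable]: "(\<lambda>x. f (x + of_int k * L)) \<in> borel_measurable lebesgue" for k :: int
    by (rule measurable_compose[OF lebesgue_shift_measurable f])
  have "(\<integral>\<^sup>+x. (\<integral>\<^sup>+k. f (x + of_int k * L) \<partial>count_space (UNIV::int set)) \<partial>period_measure L)
    = (\<integral>\<^sup>+k. (\<integral>\<^sup>+x. f (x + of_int k * L) \<partial>period_measure L) \<partial>count_space (UNIV::int set))"
    by (intro nn_integral_count_space_nn_integral) (auto intro!: measurable_restrict_space1)
  also have "\<dots> = (\<integral>\<^sup>+k. (\<integral>\<^sup>+x. f x * indicator {0..<L} (x - of_int k * L) \<partial>lebesgue) \<partial>count_space (UNIV::int set))"
  proof (rule nn_integral_cong)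
    fix k :: int
    have ind: "(\<lambda>x. indicator {0..<L} (x - of_int k * L) :: ennreal) \<in> borel_measurable lebesgue"
      using measurable_compose[OF lebesgue_shift_measurable[of "- (of_int k * L)"]
          borel_measurable_indicator[of "{0..<L}" lebesgue]] by simp
    have "(\<integral>\<^sup>+x. f (x + of_int k * L) \<partial>period_measure L)
      = (\<integral>\<^sup>+x. f (x + of_int k * L) * indicator {0..<L} x \<partial>lebesgue)"
      by (rule nn_integral_restrict_space) simp
    also have "\<dots> = (\<integral>\<^sup>+x. f x * indicator {0..<L} (x - of_int k * L) \<partial>lebesgue)"
      using nn_integral_lebesgue_shift[OF borel_measurable_times_ennreal[OF f ind], of "of_int k * L"] by simp
    finally show "(\<integral>\<^sup>+x. f (x + of_int k * L) \<partial>period_measure L)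
      = (\<integral>\<^sup>+x. f x * indicator {0..<L} (x - of_int k * L) \<partial>lebesgue)" .
  qed
  also have "\<dots> = (\<integral>\<^sup>+x. (\<integral>\<^sup>+k. f x * indicator {0..<L} (x - of_int k * L) \<partial>count_space (UNIV::int set)) \<partial>lebesgue)"
  proof (rule nn_integral_count_space_nn_integral[symmetric])
    fix k :: int
    have "(\<lambda>x. indicator {0..<L} (x - of_int k * L) :: ennreal) \<in> borel_measurable lebesgue"
      using measurable_compose[OF lebesgue_shift_measurable[of "- (of_int k * L)"]
          borel_measurable_indicator[of "{0..<L}" lebesgue]] by simp
    then show "(\<lambda>x. f x * indicator {0..<L} (x - of_int k * L)) \<in> borel_measurable lebesgue"
      by (intro borel_measurable_times_ennreal f)
  qed simp
  also have "\<dots> = (\<integral>\<^sup>+x. f x \<partial>lebesgue)"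
    using nn_integral_period_indicator[OF L] by (simp add: nn_integral_cmult)
  finally show ?thesis .
qed

text \<open>
  The map \<open>(x, k) \<mapsto> x + k L\<close> preserves measure. Stated in this form, the tiling of the line transfers
  to null sets, to measurability and to Bochner integrals at once.
\<close>

lemma distr_tiling:
  assumes L: "0 < L"
  shows "distr (tiling_measure L) lebesgue (\<lambda>(x, k). x + of_int k * L) = lebesgue"
proof (rule measure_eqI)
  interpret sigma_finite_measure "count_space (UNIV::int set)"
    by (rule sigma_finite_measure_count_space)
  fix A assume "A \<in> sets (distr (tiling_measure L) lebesgue (\<lambda>(x, k). x + of_int k * L))"
  then have A: "A \<in> sets lebesgue" by simp
  have "emeasure (distr (tiling_measure L) lebesgue (\<lambda>(x, k). x + of_int k * L)) A
    = (\<integral>\<^sup>+y. indicator A y \<partial>distr (tiling_measure L) lebesgue (\<lambda>(x, k). x + of_int k * L))"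
    using A by (simp del: emeasure_completion)
  also have "\<dots> = (\<integral>\<^sup>+p. indicator A (case p of (x, k) \<Rightarrow> x + of_int k * L) \<partial>tiling_measure L)"
    using A by (intro nn_integral_distr tiling_map_measurable) simp
  also have "\<dots> = (\<integral>\<^sup>+x. (\<integral>\<^sup>+k. indicator A (x + of_int k * L) \<partial>count_space (UNIV::int set)) \<partial>period_measure L)"
    using measurable_compose[OF tiling_map_measurable borel_measurable_indicator[OF A]]
    by (subst nn_integral_fst[symmetric]) auto
  also have "\<dots> = emeasure lebesgue A"
    using A by (simp add: nn_integral_tiling[OF L] del: emeasure_completion)
  finally show "emeasure (distr (tiling_measure L) lebesgue (\<lambda>(x, k). x + of_int k * L)) A = emeasure lebesgue A" .
qed simp

lemma AE_periodization:
  assumes L: "0 < L" and P: "AE x in lebesgue. P x"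
  shows "AE x in period_measure L. \<forall>k::int. P (x + of_int k * L)"
proof -
  have "AE p in tiling_measure L. P (case p of (x, k) \<Rightarrow> x + of_int k * L)"
    using P by (intro AE_distrD[OF tiling_map_measurable]) (simp only: distr_tiling[OF L])
  from pair_sigma_finite.AE_pair[OF pair_sigma_finite_period this]
  show ?thesis
    by (simp add: AE_count_space)
qed

lemma
  fixes F :: "real \<Rightarrow> complex"
  assumes L: "0 < L" and F: "integrable lebesgue F"
  shows AE_summable_periodization: "AE x in period_measure L. (\<lambda>k::int. F (x + of_int k * L)) summable_on UNIV"
    and periodization_measurable: "(\<lambda>x. \<Sum>\<^sub>\<infinity>k::int. F (x + of_int k * L)) \<in> borel_measurable (period_measure L)"
    and integral_periodization: "(LINT x|period_measure L. (\<Sum>\<^sub>\<infinity>k::int. F (x + of_int k * L))) = (LINT x|lebesgue. F x)"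
proof -
  interpret pair_sigma_finite "period_measure L" "count_space (UNIV::int set)"
    by (rule pair_sigma_finite_period)
  have F': "integrable (distr (tiling_measure L) lebesgue (\<lambda>(x, k). x + of_int k * L)) F"
    using F by (simp only: distr_tiling[OF L])
  have int: "integrable (tiling_measure L) (\<lambda>(x, k). F (x + of_int k * L))"
    using integrable_distr[OF tiling_map_measurable F'] by (simp add: case_prod_beta')
  then have meas: "(\<lambda>(x, k). F (x + of_int k * L)) \<in> borel_measurable (tiling_measure L)"
    by simp
  show "AE x in period_measure L. (\<lambda>k::int. F (x + of_int k * L)) summable_on UNIV"
    using AE_integrable_fst'[OF int]
  proof eventually_elim
    case (elim x)
    then show ?case
      using abs_summable_equivalent[of "\<lambda>k::int. F (x + of_int k * L)" UNIV]
      by (simp add: Infinite_Set_Sum.abs_summable_on_def summable_on_iff_abs_summable_on_complex)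
  qed
  show "(\<lambda>x. \<Sum>\<^sub>\<infinity>k::int. F (x + of_int k * L)) \<in> borel_measurable (period_measure L)"
    unfolding infsum_complex_eq_integral
    using M2.borel_measurable_lebesgue_integral[OF meas] .
  have "(LINT x|period_measure L. (\<Sum>\<^sub>\<infinity>k::int. F (x + of_int k * L))) = integral\<^sup>L (tiling_measure L) (\<lambda>(x, k). F (x + of_int k * L))"
    unfolding infsum_complex_eq_integral using integral_fst'[OF int] by simp
  also have "\<dots> = integral\<^sup>L (distr (tiling_measure L) lebesgue (\<lambda>(x, k). x + of_int k * L)) F"
    using borel_measurable_integrable[OF F]
    by (subst integral_distr[OF tiling_map_measurable]) (auto simp: case_prod_beta')
  finally show "(LINT x|period_measure L. (\<Sum>\<^sub>\<infinity>k::int. F (x + of_int k * L))) = (LINT x|lebesgue. F x)"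
    by (simp only: distr_tiling[OF L])
qed

section \<open>Quadratic forms with a row-sum bound\<close>

text \<open>
  A form of the triangle inequality in which the weight of \<open>u\<close> may be taken arbitrarily close to \<open>1\<close>,
  at the price of a large weight on \<open>v\<close>. It serves below where \<open>v\<close> is the tail of a convergent series.
\<close>

lemma square_norm_weighted_add_le:
  fixes u v :: "'a::real_normed_vector"
  assumes "0 < \<theta>"
  shows "(norm (u + v))\<^sup>2 \<le> (1 + \<theta>) * (norm u)\<^sup>2 + (1 + 1/\<theta>) * (norm v)\<^sup>2"
proof -
  have "(norm (u + v))\<^sup>2 \<le> (norm u + norm v)\<^sup>2"
    by (intro power_mono norm_triangle_ineq) simp
  also have "\<dots> = (1 + \<theta>) * (norm u)\<^sup>2 + (1 + 1/\<theta>) * (norm v)\<^sup>2 - (\<theta> * norm u - norm v)\<^sup>2 / \<theta>"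
    using assms by (simp add: power2_eq_square field_simps)
  also have "\<dots> \<le> (1 + \<theta>) * (norm u)\<^sup>2 + (1 + 1/\<theta>) * (norm v)\<^sup>2"
    using assms by simp
  finally show ?thesis .
qed

lemma summable_on_mult_cnj:
  assumes "(\<lambda>n. (cmod (u n))\<^sup>2) summable_on A" "(\<lambda>n. (cmod (v n))\<^sup>2) summable_on A"
  shows "(\<lambda>n. u n * cnj (v n)) summable_on A"
proof (rule abs_summable_summable)
  have "(\<lambda>n. (cmod (u n))\<^sup>2 + (cmod (v n))\<^sup>2) summable_on A"
    using assms by (rule summable_on_add)
  then show "(\<lambda>n. cmod (u n * cnj (v n))) summable_on A"
  proof (rule summable_on_comparison_test)
    fix n
    have "cmod (u n) * cmod (v n) \<le> (cmod (u n))\<^sup>2 + (cmod (v n))\<^sup>2"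
      using sum_squares_bound[of "cmod (u n)" "cmod (v n)"]
        mult_nonneg_nonneg[OF norm_ge_zero[of "u n"] norm_ge_zero[of "v n"]] by linarith
    then show "cmod (u n * cnj (v n)) \<le> (cmod (u n))\<^sup>2 + (cmod (v n))\<^sup>2"
      by (simp add: norm_mult)
  qed simp
qed

lemma has_sum_finite_sum:
  fixes f :: "'i \<Rightarrow> 'n \<Rightarrow> 'a::{topological_comm_monoid_add, t2_space}"
  assumes "finite I" "\<And>i. i \<in> I \<Longrightarrow> (f i has_sum S i) A"
  shows "((\<lambda>n. \<Sum>i\<in>I. f i n) has_sum (\<Sum>i\<in>I. S i)) A"
  using assms by (induction I) (simp_all add: has_sum_add)

text \<open>
  The rows \<open>u k\<close> are square summable vectors and \<open>C\<close> is their Gram matrix, whose absolute row sums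
  are bounded by \<open>B\<close>. The operator under study sends \<open>c\<close> to the sequence
  \<open>n \<mapsto> \<Sum>\<^sub>k c k * cnj (u k n)\<close>; the squared norm of the image is the quadratic form of \<open>C\<close> at \<open>c\<close>,
  which the absolute row sums control from above and, if \<open>C\<close> is diagonally dominant, from below.
\<close>

locale correlation_matrix =
  fixes u :: "'k \<Rightarrow> 'n \<Rightarrow> complex" and C :: "'k \<Rightarrow> 'k \<Rightarrow> complex" and B :: real
  assumes row_summable: "\<And>k. (\<lambda>n. (cmod (u k n))\<^sup>2) summable_on UNIV"
    and C_eq: "\<And>k l. C k l = (\<Sum>\<^sub>\<infinity>n. u k n * cnj (u l n))"
    and C_bound: "\<And>k F. finite F \<Longrightarrow> (\<Sum>l\<in>F. cmod (C k l)) \<le> B"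
begin

lemma C_has_sum: "((\<lambda>n. u k n * cnj (u l n)) has_sum C k l) UNIV"
  unfolding C_eq by (intro has_sum_infsum summable_on_mult_cnj row_summable)

lemma C_sym: "C l k = cnj (C k l)"
  by (simp add: C_eq infsum_cnj[symmetric] mult.commute)

lemma cmod_C_sym: "cmod (C l k) = cmod (C k l)"
  by (subst C_sym) simp

lemma B_nonneg: "0 \<le> B"
  using C_bound[of "{}"] by simp

lemma finite_quadratic_form:
  assumes K: "finite K"
  shows "((\<lambda>n. (cmod (\<Sum>k\<in>K. c k * cnj (u k n)))\<^sup>2) has_sum
    (\<Sum>k\<in>K. \<Sum>l\<in>K. Re (c k * cnj (c l) * C l k))) UNIV"
proof -
  have "((\<lambda>n. \<Sum>k\<in>K. \<Sum>l\<in>K. c k * cnj (c l) * (u l n * cnj (u k n))) has_sum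
    (\<Sum>k\<in>K. \<Sum>l\<in>K. c k * cnj (c l) * C l k)) UNIV"
    by (intro has_sum_finite_sum has_sum_cmult_right C_has_sum K)
  from has_sum_Re[OF this]
  have "((\<lambda>n. Re (\<Sum>k\<in>K. \<Sum>l\<in>K. c k * cnj (c l) * (u l n * cnj (u k n)))) has_sum
    (\<Sum>k\<in>K. \<Sum>l\<in>K. Re (c k * cnj (c l) * C l k))) UNIV"
    by simp
  moreover have "(\<Sum>k\<in>K. \<Sum>l\<in>K. c k * cnj (c l) * (u l n * cnj (u k n)))
      = of_real ((cmod (\<Sum>k\<in>K. c k * cnj (u k n)))\<^sup>2)" for n
    unfolding complex_norm_square by (simp add: sum_product mult_ac)
  ultimately show ?thesis
    by (simp only: Re_complex_of_real)
qed

text \<open>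
  Schur's test. Each off-diagonal term is at most \<open>\<bar>C k l\<bar> * (\<bar>c k\<bar>\<^sup>2 + \<bar>c l\<bar>\<^sup>2) / 2\<close>, and since \<open>\<bar>C k l\<bar>\<close>
  is symmetric the two halves have equal sums.
\<close>

lemma off_diagonal_bound:
  assumes K: "finite K"
  shows "\<bar>(\<Sum>k\<in>K. \<Sum>l\<in>K. Re (c k * cnj (c l) * C l k)) - (\<Sum>k\<in>K. (cmod (c k))\<^sup>2 * Re (C k k))\<bar>
    \<le> (\<Sum>k\<in>K. (cmod (c k))\<^sup>2 * (\<Sum>l\<in>K - {k}. cmod (C k l)))"
proof -
  have "(\<Sum>l\<in>K. Re (c k * cnj (c l) * C l k)) = (cmod (c k))\<^sup>2 * Re (C k k) + (\<Sum>l\<in>K - {k}. Re (c k * cnj (c l) * C l k))"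
    if "k \<in> K" for k
  proof -
    have "Re (c k * cnj (c k) * C k k) = (cmod (c k))\<^sup>2 * Re (C k k)"
      unfolding complex_norm_square[symmetric] by (simp del: of_real_power)
    then show ?thesis
      using sum.remove[OF K that, of "\<lambda>l. Re (c k * cnj (c l) * C l k)"] by (simp only:)
  qed
  then have "(\<Sum>k\<in>K. \<Sum>l\<in>K. Re (c k * cnj (c l) * C l k)) - (\<Sum>k\<in>K. (cmod (c k))\<^sup>2 * Re (C k k))
      = (\<Sum>k\<in>K. \<Sum>l\<in>K - {k}. Re (c k * cnj (c l) * C l k))"
    by (simp add: sum.distrib)
  also have "\<bar>\<dots>\<bar> \<le> (\<Sum>k\<in>K. \<Sum>l\<in>K - {k}. \<bar>Re (c k * cnj (c l) * C l k)\<bar>)"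
    by (rule order_trans[OF sum_abs]) (intro sum_mono sum_abs)
  also have "\<dots> \<le> (\<Sum>k\<in>K. \<Sum>l\<in>K - {k}. (cmod (c k))\<^sup>2 * cmod (C k l) / 2 + (cmod (c l))\<^sup>2 * cmod (C k l) / 2)"
  proof (intro sum_mono)
    fix k l
    have "\<bar>Re (c k * cnj (c l) * C l k)\<bar> \<le> cmod (c k) * cmod (c l) * cmod (C k l)"
      using abs_Re_le_cmod[of "c k * cnj (c l) * C l k"] by (simp add: norm_mult cmod_C_sym[of l k])
    also have "\<dots> \<le> ((cmod (c k))\<^sup>2 / 2 + (cmod (c l))\<^sup>2 / 2) * cmod (C k l)"
      using sum_squares_bound[of "cmod (c k)" "cmod (c l)"] by (intro mult_right_mono) auto
    finally show "\<bar>Re (c k * cnj (c l) * C l k)\<bar> \<le> (cmod (c k))\<^sup>2 * cmod (C k l) / 2 + (cmod (c l))\<^sup>2 * cmod (C k l) / 2"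
      by (simp add: ring_distribs)
  qed
  also have "\<dots> = (\<Sum>k\<in>K. \<Sum>l\<in>K - {k}. (cmod (c k))\<^sup>2 * cmod (C k l) / 2)
      + (\<Sum>k\<in>K. \<Sum>l\<in>K - {k}. (cmod (c l))\<^sup>2 * cmod (C k l) / 2)"
    by (simp only: sum.distrib)
  also have "(\<Sum>k\<in>K. \<Sum>l\<in>K - {k}. (cmod (c l))\<^sup>2 * cmod (C k l) / 2)
      = (\<Sum>k\<in>K. \<Sum>l\<in>K - {k}. (cmod (c k))\<^sup>2 * cmod (C k l) / 2)"
  proof -
    have "(\<Sum>k\<in>K. \<Sum>l\<in>K - {k}. (cmod (c l))\<^sup>2 * cmod (C k l) / 2)
      = (\<Sum>k\<in>K. \<Sum>l\<in>{l \<in> K. l \<noteq> k}. (cmod (c l))\<^sup>2 * cmod (C k l) / 2)"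
      by (intro sum.cong) auto
    also have "\<dots> = (\<Sum>l\<in>K. \<Sum>k\<in>{k \<in> K. l \<noteq> k}. (cmod (c l))\<^sup>2 * cmod (C k l) / 2)"
      by (rule sum.swap_restrict[OF K K])
    also have "\<dots> = (\<Sum>k\<in>K. \<Sum>l\<in>K - {k}. (cmod (c k))\<^sup>2 * cmod (C k l) / 2)"
    proof (rule sum.cong[OF refl])
      fix l assume "l \<in> K"
      have "{k \<in> K. l \<noteq> k} = K - {l}" by auto
      then show "(\<Sum>k\<in>{k \<in> K. l \<noteq> k}. (cmod (c l))\<^sup>2 * cmod (C k l) / 2)
          = (\<Sum>k\<in>K - {l}. (cmod (c l))\<^sup>2 * cmod (C l k) / 2)"
        by (simp only: cmod_C_sym[of l])
    qed
    finally show ?thesis .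
  qed
  also have "(\<Sum>k\<in>K. \<Sum>l\<in>K - {k}. (cmod (c k))\<^sup>2 * cmod (C k l) / 2)
      = (\<Sum>k\<in>K. (cmod (c k))\<^sup>2 * (\<Sum>l\<in>K - {k}. cmod (C k l))) / 2"
    by (simp only: sum_distrib_left sum_divide_distrib)
  finally show ?thesis
    by simp
qed

lemma finite_upper_bound:
  assumes K: "finite K"
  shows "(\<Sum>k\<in>K. \<Sum>l\<in>K. Re (c k * cnj (c l) * C l k)) \<le> B * (\<Sum>k\<in>K. (cmod (c k))\<^sup>2)"
proof -
  have "(\<Sum>k\<in>K. \<Sum>l\<in>K. Re (c k * cnj (c l) * C l k))
    \<le> (\<Sum>k\<in>K. (cmod (c k))\<^sup>2 * Re (C k k)) + (\<Sum>k\<in>K. (cmod (c k))\<^sup>2 * (\<Sum>l\<in>K - {k}. cmod (C k l)))"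
    using off_diagonal_bound[OF K, of c] by linarith
  also have "\<dots> = (\<Sum>k\<in>K. (cmod (c k))\<^sup>2 * (Re (C k k) + (\<Sum>l\<in>K - {k}. cmod (C k l))))"
    by (simp add: sum.distrib ring_distribs)
  also have "\<dots> \<le> (\<Sum>k\<in>K. (cmod (c k))\<^sup>2 * B)"
  proof (intro sum_mono mult_left_mono)
    fix k assume "k \<in> K"
    have "Re (C k k) + (\<Sum>l\<in>K - {k}. cmod (C k l)) \<le> (\<Sum>l\<in>K. cmod (C k l))"
      using sum.remove[OF K \<open>k \<in> K\<close>, of "\<lambda>l. cmod (C k l)"] complex_Re_le_cmod[of "C k k"] by simp
    then show "Re (C k k) + (\<Sum>l\<in>K - {k}. cmod (C k l)) \<le> B"
      using C_bound[OF K, of k] by linarith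
  qed simp
  finally show ?thesis
    by (simp add: sum_distrib_left mult.commute)
qed

text \<open>
  Dominance is required only of rows in the support of \<open>c\<close>: the other rows carry no weight in the
  off-diagonal bound.
\<close>

lemma finite_lower_bound:
  assumes K: "finite K"
    and dom: "\<And>k. k \<in> K \<Longrightarrow> c k \<noteq> 0 \<Longrightarrow> A + (\<Sum>l\<in>K - {k}. cmod (C k l)) \<le> Re (C k k)"
  shows "A * (\<Sum>k\<in>K. (cmod (c k))\<^sup>2) \<le> (\<Sum>k\<in>K. \<Sum>l\<in>K. Re (c k * cnj (c l) * C l k))"
proof -
  have "A * (\<Sum>k\<in>K. (cmod (c k))\<^sup>2) \<le> (\<Sum>k\<in>K. (cmod (c k))\<^sup>2 * (Re (C k k) - (\<Sum>l\<in>K - {k}. cmod (C k l))))"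
    unfolding sum_distrib_left
  proof (rule sum_mono)
    fix k assume "k \<in> K"
    show "A * (cmod (c k))\<^sup>2 \<le> (cmod (c k))\<^sup>2 * (Re (C k k) - (\<Sum>l\<in>K - {k}. cmod (C k l)))"
    proof (cases "c k = 0")
      case False
      then have "A \<le> Re (C k k) - (\<Sum>l\<in>K - {k}. cmod (C k l))"
        using dom[OF \<open>k \<in> K\<close>] by simp
      then show ?thesis
        by (subst mult.commute) (intro mult_left_mono; simp)
    qed simp
  qed
  also have "\<dots> = (\<Sum>k\<in>K. (cmod (c k))\<^sup>2 * Re (C k k)) - (\<Sum>k\<in>K. (cmod (c k))\<^sup>2 * (\<Sum>l\<in>K - {k}. cmod (C k l)))"
    by (simp add: sum_subtractf ring_distribs)
  also have "\<dots> \<le> (\<Sum>k\<in>K. \<Sum>l\<in>K. Re (c k * cnj (c l) * C l k))"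
    using off_diagonal_bound[OF K, of c] by linarith
  finally show ?thesis .
qed

text \<open>
  For finitely many \<open>n\<close>, the sums over finite sets \<open>K\<close> of indices \<open>k\<close> converge, so the bound for
  finite \<open>K\<close> survives the limit; then the set of \<open>n\<close> grows.
\<close>

lemma upper_bound:
  assumes c: "(\<lambda>k. (cmod (c k))\<^sup>2) summable_on UNIV"
    and P: "\<And>n. ((\<lambda>k. c k * cnj (u k n)) has_sum P n) UNIV"
  shows "(\<lambda>n. (cmod (P n))\<^sup>2) summable_on UNIV"
    and "(\<Sum>\<^sub>\<infinity>n. (cmod (P n))\<^sup>2) \<le> B * (\<Sum>\<^sub>\<infinity>k. (cmod (c k))\<^sup>2)"
proof -
  let ?S = "\<Sum>\<^sub>\<infinity>k. (cmod (c k))\<^sup>2"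
  have fin: "(\<Sum>n\<in>N. (cmod (P n))\<^sup>2) \<le> B * ?S" if N: "finite N" for N
  proof (rule tendsto_upperbound)
    show "((\<lambda>K. \<Sum>n\<in>N. (cmod (\<Sum>k\<in>K. c k * cnj (u k n)))\<^sup>2) \<longlongrightarrow> (\<Sum>n\<in>N. (cmod (P n))\<^sup>2)) (finite_subsets_at_top UNIV)"
      by (intro tendsto_intros P[unfolded has_sum_def])
    have "(\<Sum>n\<in>N. (cmod (\<Sum>k\<in>K. c k * cnj (u k n)))\<^sup>2) \<le> B * ?S" if K: "finite K" for K
    proof -
      have "(\<Sum>n\<in>N. (cmod (\<Sum>k\<in>K. c k * cnj (u k n)))\<^sup>2) \<le> (\<Sum>k\<in>K. \<Sum>l\<in>K. Re (c k * cnj (c l) * C l k))"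
        using has_sum_mono2[OF has_sum_finite[OF N] finite_quadratic_form[OF K, of c]] by simp
      also have "\<dots> \<le> B * (\<Sum>k\<in>K. (cmod (c k))\<^sup>2)"
        by (rule finite_upper_bound[OF K])
      also have "\<dots> \<le> B * ?S"
        by (intro mult_left_mono finite_sum_le_infsum c K B_nonneg) auto
      finally show ?thesis .
    qed
    then show "\<forall>\<^sub>F K in finite_subsets_at_top UNIV. (\<Sum>n\<in>N. (cmod (\<Sum>k\<in>K. c k * cnj (u k n)))\<^sup>2) \<le> B * ?S"
      by (auto simp: eventually_finite_subsets_at_top)
  qed simp
  show *: "(\<lambda>n. (cmod (P n))\<^sup>2) summable_on UNIV"
    by (rule nonneg_bdd_above_summable_on) (use fin in \<open>auto intro!: bdd_aboveI\<close>)
  show "(\<Sum>\<^sub>\<infinity>n. (cmod (P n))\<^sup>2) \<le> B * ?S"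
    by (rule infsum_le_finite_sums[OF *]) (use fin in auto)
qed

text \<open>
  A lower bound does not pass to limits coordinate by coordinate. Instead the truncation of \<open>c\<close> to a
  finite set \<open>K\<close> is compared with \<open>c\<close> itself: the image of the tail of \<open>c\<close> is small in norm by the
  upper bound applied to that tail. Hence the estimate holds up to a factor \<open>1 + \<theta>\<close> for every
  \<open>\<theta> > 0\<close>.
\<close>

lemma lower_bound:
  assumes c: "(\<lambda>k. (cmod (c k))\<^sup>2) summable_on UNIV"
    and P: "\<And>n. ((\<lambda>k. c k * cnj (u k n)) has_sum P n) UNIV"
    and dom: "\<And>k F. c k \<noteq> 0 \<Longrightarrow> finite F \<Longrightarrow> k \<notin> F \<Longrightarrow> A + (\<Sum>l\<in>F. cmod (C k l)) \<le> Re (C k k)"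
  shows "A * (\<Sum>\<^sub>\<infinity>k. (cmod (c k))\<^sup>2) \<le> (\<Sum>\<^sub>\<infinity>n. (cmod (P n))\<^sup>2)"
proof -
  let ?S = "\<Sum>\<^sub>\<infinity>k. (cmod (c k))\<^sup>2" and ?T = "\<Sum>\<^sub>\<infinity>n. (cmod (P n))\<^sup>2"
  have T: "((\<lambda>n. (cmod (P n))\<^sup>2) has_sum ?T) UNIV"
    using upper_bound(1)[OF c P] by simp
  have S: "((\<lambda>k. (cmod (c k))\<^sup>2) has_sum ?S) UNIV"
    using c by simp
  have fin: "A * (\<Sum>k\<in>K. (cmod (c k))\<^sup>2) \<le> (1 + \<theta>) * ?T + (1 + 1/\<theta>) * (B * (?S - (\<Sum>k\<in>K. (cmod (c k))\<^sup>2)))"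
    if \<theta>: "0 < \<theta>" and K: "finite K" for \<theta> K
  proof -
    define d where "d k = (if k \<in> K then 0 else c k)" for k
    define Q where "Q n = (\<Sum>k\<in>K. c k * cnj (u k n))" for n
    have d: "((\<lambda>k. (cmod (d k))\<^sup>2) has_sum (?S - (\<Sum>k\<in>K. (cmod (c k))\<^sup>2))) UNIV"
    proof -
      have "((\<lambda>k. (cmod (c k))\<^sup>2) has_sum (?S - (\<Sum>k\<in>K. (cmod (c k))\<^sup>2))) (UNIV - K)"
        by (intro has_sum_Diff S has_sum_finite K) simp
      then show ?thesis
        by (rule has_sum_cong_neutral[THEN iffD1, rotated -1]) (auto simp: d_def)
    qed
    have dP: "((\<lambda>k. d k * cnj (u k n)) has_sum (P n - Q n)) UNIV" for n
    proof -
      have "((\<lambda>k. c k * cnj (u k n)) has_sum (P n - Q n)) (UNIV - K)"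
        unfolding Q_def by (intro has_sum_Diff P has_sum_finite K) simp
      then show ?thesis
        by (rule has_sum_cong_neutral[THEN iffD1, rotated -1]) (auto simp: d_def)
    qed
    have tail: "(\<lambda>n. (cmod (P n - Q n))\<^sup>2) summable_on UNIV"
        "(\<Sum>\<^sub>\<infinity>n. (cmod (P n - Q n))\<^sup>2) \<le> B * (?S - (\<Sum>k\<in>K. (cmod (c k))\<^sup>2))"
      using upper_bound[OF has_sum_imp_summable[OF d] dP] infsumI[OF d] by simp_all
    have "A * (\<Sum>k\<in>K. (cmod (c k))\<^sup>2) \<le> (\<Sum>k\<in>K. \<Sum>l\<in>K. Re (c k * cnj (c l) * C l k))"
      using K dom by (intro finite_lower_bound) auto
    also have "\<dots> \<le> (1 + \<theta>) * ?T + (1 + 1/\<theta>) * (\<Sum>\<^sub>\<infinity>n. (cmod (P n - Q n))\<^sup>2)"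
    proof (rule has_sum_mono)
      show "((\<lambda>n. (cmod (Q n))\<^sup>2) has_sum (\<Sum>k\<in>K. \<Sum>l\<in>K. Re (c k * cnj (c l) * C l k))) UNIV"
        unfolding Q_def by (rule finite_quadratic_form[OF K])
      show "((\<lambda>n. (1 + \<theta>) * (cmod (P n))\<^sup>2 + (1 + 1/\<theta>) * (cmod (P n - Q n))\<^sup>2) has_sum
          (1 + \<theta>) * ?T + (1 + 1/\<theta>) * (\<Sum>\<^sub>\<infinity>n. (cmod (P n - Q n))\<^sup>2)) UNIV"
        by (intro has_sum_add has_sum_cmult_right T has_sum_infsum tail)
      fix n
      show "(cmod (Q n))\<^sup>2 \<le> (1 + \<theta>) * (cmod (P n))\<^sup>2 + (1 + 1/\<theta>) * (cmod (P n - Q n))\<^sup>2"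
        using square_norm_weighted_add_le[OF \<theta>, of "P n" "Q n - P n"] by (simp add: norm_minus_commute)
    qed
    also have "\<dots> \<le> (1 + \<theta>) * ?T + (1 + 1/\<theta>) * (B * (?S - (\<Sum>k\<in>K. (cmod (c k))\<^sup>2)))"
      using tail(2) \<theta> by (intro add_left_mono mult_left_mono) auto
    finally show ?thesis .
  qed
  have \<theta>: "A * ?S \<le> (1 + \<theta>) * ?T" if \<theta>: "0 < \<theta>" for \<theta>
  proof -
    have "A * ?S \<le> (1 + \<theta>) * ?T + (1 + 1/\<theta>) * (B * (?S - ?S))"
    proof (rule tendsto_le)
      show "((\<lambda>K. A * (\<Sum>k\<in>K. (cmod (c k))\<^sup>2)) \<longlongrightarrow> A * ?S) (finite_subsets_at_top UNIV)"
        by (intro tendsto_intros S[unfolded has_sum_def])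
      show "((\<lambda>K. (1 + \<theta>) * ?T + (1 + 1/\<theta>) * (B * (?S - (\<Sum>k\<in>K. (cmod (c k))\<^sup>2)))) \<longlongrightarrow>
          (1 + \<theta>) * ?T + (1 + 1/\<theta>) * (B * (?S - ?S))) (finite_subsets_at_top UNIV)"
        by (intro tendsto_intros S[unfolded has_sum_def])
      show "\<forall>\<^sub>F K in finite_subsets_at_top UNIV. A * (\<Sum>k\<in>K. (cmod (c k))\<^sup>2)
          \<le> (1 + \<theta>) * ?T + (1 + 1/\<theta>) * (B * (?S - (\<Sum>k\<in>K. (cmod (c k))\<^sup>2)))"
        using fin[OF \<theta>] by (auto simp: eventually_finite_subsets_at_top)
    qed simp
    then show ?thesis by simp
  qed
  show ?thesis
  proof (rule tendsto_lowerbound)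
    show "((\<lambda>\<theta>. (1 + \<theta>) * ?T) \<longlongrightarrow> ?T) (at_right 0)"
      by (rule tendsto_eq_intros refl | simp)+
    show "\<forall>\<^sub>F \<theta> in at_right 0. A * ?S \<le> (1 + \<theta>) * ?T"
      using \<theta> by (auto simp: eventually_at_filter)
  qed simp
qed

end

section \<open>Sums of nonnegative families\<close>

lemma sum_le_infsum_ennreal:
  fixes h :: "'i \<Rightarrow> ennreal"
  assumes "finite F" "F \<subseteq> A"
  shows "sum h F \<le> infsum h A"
  using assms by (subst nonneg_infsum_complete) (auto intro: SUP_upper)

lemma ennreal_infsum:
  fixes h :: "'i \<Rightarrow> real"
  assumes "h summable_on UNIV" "\<And>i. 0 \<le> h i"
  shows "ennreal (\<Sum>\<^sub>\<infinity>i. h i) = (\<Sum>\<^sub>\<infinity>i. ennreal (h i))"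
proof -
  have "ennreal (\<Sum>\<^sub>\<infinity>i. h i) = (SUP F\<in>{F. finite F \<and> F \<subseteq> UNIV}. ennreal (sum h F))"
    using assms by (intro infsum_nonneg_is_SUPREMUM_ennreal) auto
  also have "\<dots> = (SUP F\<in>{F. finite F \<and> F \<subseteq> UNIV}. \<Sum>i\<in>F. ennreal (h i))"
    using assms(2) by (simp add: sum_ennreal)
  also have "\<dots> = (\<Sum>\<^sub>\<infinity>i. ennreal (h i))"
    by (rule nonneg_infsum_complete[symmetric]) simp
  finally show ?thesis .
qed

lemma summable_on_if_ennreal_finite:
  fixes h :: "'i \<Rightarrow> real"
  assumes "(\<Sum>\<^sub>\<infinity>i. ennreal (h i)) < \<infinity>" "\<And>i. 0 \<le> h i"
  shows "h summable_on UNIV"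
proof (rule nonneg_bdd_above_summable_on)
  show "bdd_above (sum h ` {F. F \<subseteq> UNIV \<and> finite F})"
  proof (rule bdd_aboveI2)
    fix F assume F: "F \<in> {F :: 'i set. F \<subseteq> UNIV \<and> finite F}"
    have "ennreal (sum h F) \<le> (\<Sum>\<^sub>\<infinity>i. ennreal (h i))"
      using sum_le_infsum_ennreal[of F UNIV "\<lambda>i. ennreal (h i)"] F assms(2) by (simp add: sum_ennreal)
    then show "sum h F \<le> enn2real (\<Sum>\<^sub>\<infinity>i. ennreal (h i))"
      using assms by (metis enn2real_ennreal enn2real_mono infinity_ennreal_def sum_nonneg)
  qed
qed (use assms(2) in auto)

section \<open>The Gabor system\<close>

lemma bij_int_add: "bij ((+) (j::int))"
  by (rule o_bij[of "(+) (- j)"]) auto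

lemma G_fun_periodic: "G_fun g a (x + of_int j * a) = G_fun g a x"
proof -
  have "G_fun g a (x + of_int j * a) = (\<Sum>\<^sub>\<infinity>n. ennreal ((cmod (g (x + of_int j * a - of_int (j + n) * a)))\<^sup>2))"
    unfolding G_fun_def by (rule infsum_reindex_bij_betw[symmetric, OF bij_int_add])
  also have "\<dots> = G_fun g a x"
    unfolding G_fun_def by (simp add: algebra_simps)
  finally show ?thesis .
qed

lemma abs_corr_periodic: "abs_corr g a b k (x + of_int j * a) = abs_corr g a b k x"
proof -
  define h where "h y n = g (y - of_int n * a) * cnj (g (y - of_int n * a - of_int k / b))" for y and n :: int
  have shift: "h (x + of_int j * a) (j + n) = h x n" for n
    by (simp add: h_def algebra_simps)
  have "h (x + of_int j * a) summable_on UNIV \<longleftrightarrow> h x summable_on UNIV"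
    using summable_on_reindex_bij_betw[OF bij_int_add, of "h (x + of_int j * a)" j] by (simp add: shift)
  moreover have "infsum (h (x + of_int j * a)) UNIV = infsum (h x) UNIV"
    using infsum_reindex_bij_betw[OF bij_int_add, of "h (x + of_int j * a)" j] by (simp add: shift)
  ultimately show ?thesis
    unfolding abs_corr_def Let_def h_def by simp
qed

text \<open>
  This includes the divergent case, where both sides are infinite. Consequently the hypothesis on \<open>B\<close>
  makes \<open>G\<close> bounded.
\<close>

lemma abs_corr_zero: "abs_corr g a b 0 x = G_fun g a x"
proof -
  define h where "h n = (cmod (g (x - of_int n * a)))\<^sup>2" for n :: int
  have h: "g (x - of_int n * a) * cnj (g (x - of_int n * a - of_int 0 / b)) = of_real (h n)" for n
    by (simp only: h_def complex_norm_square) simp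
  have G: "G_fun g a x = (\<Sum>\<^sub>\<infinity>n. ennreal (h n))"
    by (simp only: G_fun_def h_def)
  show ?thesis
  proof (cases "h summable_on UNIV")
    case True
    have "((\<lambda>n. complex_of_real (h n)) has_sum of_real (\<Sum>\<^sub>\<infinity>n. h n)) UNIV"
      by (intro has_sum_of_real has_sum_infsum True)
    moreover have "G_fun g a x = ennreal (\<Sum>\<^sub>\<infinity>n. h n)"
      unfolding G by (rule ennreal_infsum[symmetric, OF True]) (simp add: h_def)
    moreover have "0 \<le> (\<Sum>\<^sub>\<infinity>n. h n)"
      by (intro infsum_nonneg) (simp add: h_def)
    ultimately show ?thesis
      unfolding abs_corr_def Let_def h using has_sum_imp_summable infsumI by fastforce
  next
    case False
    then have "\<not> (\<lambda>n. complex_of_real (h n)) summable_on UNIV"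
      using summable_on_Re by fastforce
    moreover have "\<not> G_fun g a x < \<infinity>"
      using summable_on_if_ennreal_finite[of h] False unfolding G by (auto simp: h_def)
    ultimately show ?thesis
      unfolding abs_corr_def Let_def h by (simp add: not_less top_unique)
  qed
qed

lemma G_fun_le_corr_sum: "G_fun g a x \<le> (\<Sum>\<^sub>\<infinity>k. abs_corr g a b k x)"
  using sum_le_infsum_ennreal[of "{0}" UNIV "\<lambda>k. abs_corr g a b k x"] by (simp add: abs_corr_zero)

text \<open>
  The two hypotheses in pointwise form on the whole line. The lower one is written additively, since
  subtraction of extended nonnegative numbers truncates.
\<close>

locale gabor_estimates =
  fixes g :: "real \<Rightarrow> complex" and a b A B :: real
  assumes g_L2: "g \<in> L2" and b_pos: "0 < b" and A_pos: "0 < A" and B_pos: "0 < B"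
    and corr_upper: "\<And>y. (\<Sum>\<^sub>\<infinity>k. abs_corr g a b k y) \<le> ennreal B"
    and corr_lower: "\<And>y. y \<notin> N_G g a \<Longrightarrow> ennreal A + (\<Sum>\<^sub>\<infinity>k\<in>UNIV - {0}. abs_corr g a b k y) \<le> G_fun g a y"
begin

definition L :: real where "L = 1 / b"

lemma L_pos: "0 < L"
  using b_pos by (simp add: L_def)

text \<open>
  The samples of the translates of \<open>g\<close> along the orbit of \<open>x\<close> under shifts by \<open>L\<close>, and their Gram
  matrix. Its entries are the correlation sums of \<open>g\<close> at the points of that orbit.
\<close>

definition u :: "real \<Rightarrow> int \<Rightarrow> int \<Rightarrow> complex" where
  "u x k n = g (x + of_int k * L - of_int n * a)"

definition C :: "real \<Rightarrow> int \<Rightarrow> int \<Rightarrow> complex" where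
  "C x k l = (\<Sum>\<^sub>\<infinity>n. u x k n * cnj (u x l n))"

lemma row_summable: "(\<lambda>n. (cmod (u x k n))\<^sup>2) summable_on UNIV"
proof (rule summable_on_if_ennreal_finite)
  have "(\<Sum>\<^sub>\<infinity>n. ennreal ((cmod (u x k n))\<^sup>2)) = G_fun g a (x + of_int k * L)"
    by (simp add: G_fun_def u_def)
  also have "\<dots> \<le> ennreal B"
    using G_fun_le_corr_sum corr_upper by (rule order_trans)
  finally show "(\<Sum>\<^sub>\<infinity>n. ennreal ((cmod (u x k n))\<^sup>2)) < \<infinity>"
    by (auto simp: less_top[symmetric] top_unique)
qed simp

lemma G_fun_eq: "G_fun g a (x + of_int k * L) = ennreal (Re (C x k k))"
proof -
  have "C x k k = (\<Sum>\<^sub>\<infinity>n. of_real ((cmod (u x k n))\<^sup>2))"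
    by (simp only: C_def complex_norm_square)
  also have "\<dots> = of_real (\<Sum>\<^sub>\<infinity>n. (cmod (u x k n))\<^sup>2)"
    by (intro infsumI has_sum_of_real has_sum_infsum row_summable)
  finally have "ennreal (Re (C x k k)) = ennreal (\<Sum>\<^sub>\<infinity>n. (cmod (u x k n))\<^sup>2)"
    by simp
  also have "\<dots> = G_fun g a (x + of_int k * L)"
    unfolding G_fun_def by (subst ennreal_infsum[OF row_summable]) (simp_all add: u_def)
  finally show ?thesis by simp
qed

text \<open>
  The correlation sum with lag \<open>k - l\<close>, taken at the \<open>k\<close>-th point of the orbit, pairs that point with
  the \<open>l\<close>-th one. A bound for the sum over all lags at every point thus bounds all row sums.
\<close>

lemma abs_corr_eq: "abs_corr g a b (k - l) (x + of_int k * L) = ennreal (cmod (C x k l))"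
proof -
  have "g (x + of_int k * L - of_int n * a - of_int (k - l) / b) = u x l n" for n
    by (simp add: u_def L_def algebra_simps diff_divide_distrib)
  moreover have "(\<lambda>n. u x k n * cnj (u x l n)) summable_on UNIV"
    by (intro summable_on_mult_cnj row_summable)
  ultimately show ?thesis
    by (simp add: abs_corr_def C_def u_def[symmetric])
qed

lemma corr_sum_le:
  assumes "finite F" "(\<lambda>l. k - l) ` F \<subseteq> J"
  shows "ennreal (\<Sum>l\<in>F. cmod (C x k l)) \<le> (\<Sum>\<^sub>\<infinity>j\<in>J. abs_corr g a b j (x + of_int k * L))"
proof -
  have "ennreal (\<Sum>l\<in>F. cmod (C x k l)) = (\<Sum>l\<in>F. abs_corr g a b (k - l) (x + of_int k * L))"
    by (simp add: abs_corr_eq sum_ennreal)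
  also have "\<dots> = (\<Sum>j\<in>(\<lambda>l. k - l) ` F. abs_corr g a b j (x + of_int k * L))"
    by (subst sum.reindex) (auto simp: inj_on_def)
  also have "\<dots> \<le> (\<Sum>\<^sub>\<infinity>j\<in>J. abs_corr g a b j (x + of_int k * L))"
    using assms by (intro sum_le_infsum_ennreal) auto
  finally show ?thesis .
qed

lemma correlation_matrix: "correlation_matrix (u x) (C x) B"
proof
  fix k and F :: "int set" assume "finite F"
  then have "ennreal (\<Sum>l\<in>F. cmod (C x k l)) \<le> ennreal B"
    using corr_sum_le[of F k UNIV x] corr_upper[of "x + of_int k * L"] by (auto intro: order_trans)
  then show "(\<Sum>l\<in>F. cmod (C x k l)) \<le> B"
    using B_pos by simp
qed (simp_all add: row_summable C_def)

lemma diagonal_dominance: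
  assumes "x + of_int k * L \<notin> N_G g a" "finite F" "k \<notin> F"
  shows "A + (\<Sum>l\<in>F. cmod (C x k l)) \<le> Re (C x k k)"
proof -
  have "ennreal (A + (\<Sum>l\<in>F. cmod (C x k l))) = ennreal A + ennreal (\<Sum>l\<in>F. cmod (C x k l))"
    using A_pos by (intro ennreal_plus sum_nonneg) auto
  also have "\<dots> \<le> ennreal A + (\<Sum>\<^sub>\<infinity>j\<in>UNIV - {0}. abs_corr g a b j (x + of_int k * L))"
    using assms by (intro add_left_mono corr_sum_le) auto
  also have "\<dots> \<le> ennreal (Re (C x k k))"
    using corr_lower[OF assms(1)] by (simp add: G_fun_eq)
  finally have "A + (\<Sum>l\<in>F. cmod (C x k l)) \<le> Re (C x k k) \<or> A + (\<Sum>l\<in>F. cmod (C x k l)) \<le> 0"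
    unfolding ennreal_le_iff2 by blast
  then show ?thesis
    using A_pos sum_nonneg[of F "\<lambda>l. cmod (C x k l)"] by simp
qed

definition g_shift :: "int \<Rightarrow> real \<Rightarrow> complex" where
  "g_shift n = translation (of_int n * a) g"

lemma gabor_eq: "gabor g a b (m, n) y = trig_mono L m y * g_shift n y"
  by (simp add: gabor_def modulation_def trig_mono_def L_def cis_conv_exp g_shift_def mult_ac)

lemma g_shift_L2:
  shows g_shift_measurable [measurable]: "g_shift n \<in> borel_measurable lebesgue"
    and g_shift_integrable: "integrable lebesgue (\<lambda>y. (cmod (g_shift n y))\<^sup>2)"
proof -
  have g: "g \<in> borel_measurable lebesgue" "integrable lebesgue (\<lambda>x. (cmod (g x))\<^sup>2)"
    using g_L2 by (auto simp: L2_def)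
  have eq: "g_shift n = (\<lambda>y. g (y + - (of_int n * a)))"
    by (simp add: g_shift_def translation_def)
  show m: "g_shift n \<in> borel_measurable lebesgue"
    unfolding eq by (rule measurable_compose[OF lebesgue_shift_measurable g(1)])
  have "(\<integral>\<^sup>+y. ennreal ((cmod (g_shift n y))\<^sup>2) \<partial>lebesgue) = (\<integral>\<^sup>+y. ennreal ((cmod (g y))\<^sup>2) \<partial>lebesgue)"
    unfolding eq using g(1)
    by (intro nn_integral_lebesgue_shift[of "\<lambda>y. ennreal ((cmod (g y))\<^sup>2)"]) simp
  also have "\<dots> < \<infinity>"
    using g(2) by (simp add: integrable_iff_bounded)
  finally show "integrable lebesgue (\<lambda>y. (cmod (g_shift n y))\<^sup>2)"
    using m by (intro integrableI_bounded) auto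
qed

lemma gabor_L2:
  shows gabor_measurable [measurable]: "gabor g a b (m, n) \<in> borel_measurable lebesgue"
    and gabor_integrable: "integrable lebesgue (\<lambda>y. (cmod (gabor g a b (m, n) y))\<^sup>2)"
proof -
  have "gabor g a b (m, n) = (\<lambda>y. trig_mono L m y * g_shift n y)"
    by (rule ext) (rule gabor_eq)
  then show "gabor g a b (m, n) \<in> borel_measurable lebesgue"
    by simp
  show "integrable lebesgue (\<lambda>y. (cmod (gabor g a b (m, n) y))\<^sup>2)"
    using g_shift_integrable[of n] by (simp add: gabor_eq norm_mult)
qed

lemma gabor_in_L2_off: "gabor g a b i \<in> L2_off (N_G g a)"
proof -
  obtain m n where i: "i = (m, n)" by (cases i)
  have "gabor g a b (m, n) x = 0" if "x \<in> N_G g a" for x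
  proof -
    have "ennreal ((cmod (g (x - of_int n * a)))\<^sup>2) \<le> G_fun g a x"
      using sum_le_infsum_ennreal[of "{n}" UNIV "\<lambda>n. ennreal ((cmod (g (x - of_int n * a)))\<^sup>2)"]
      by (simp add: G_fun_def)
    then have "g_shift n x = 0"
      using that by (simp add: N_G_def g_shift_def translation_def)
    then show ?thesis by (simp add: gabor_eq)
  qed
  then show ?thesis
    using gabor_L2[of m n] by (simp add: i L2_off_def L2_def)
qed

context
  fixes f :: "real \<Rightarrow> complex"
  assumes f: "f \<in> L2_off (N_G g a)"
begin

lemma f_measurable [measurable]: "f \<in> borel_measurable lebesgue"
  and f_integrable: "integrable lebesgue (\<lambda>y. (cmod (f y))\<^sup>2)"
  and f_zero: "AE y in lebesgue. y \<in> N_G g a \<longrightarrow> f y = 0"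
  using f by (auto simp: L2_off_def L2_def)

text \<open>
  The periodization of \<open>f\<close> times the conjugate of the \<open>n\<close>-th translate of \<open>g\<close>. For each \<open>x\<close>, the
  sequence \<open>n \<mapsto> periodized n x\<close> is the image of the samples of \<open>f\<close> along the orbit of \<open>x\<close> under the
  operator defined by \<open>u x\<close>.
\<close>

definition periodized :: "int \<Rightarrow> real \<Rightarrow> complex" where
  "periodized n x = (\<Sum>\<^sub>\<infinity>k::int. f (x + of_int k * L) * cnj (g_shift n (x + of_int k * L)))"

lemma fg_integrable: "integrable lebesgue (\<lambda>y. f y * cnj (g_shift n y))"
  by (intro integrable_mult_cnj f_measurable g_shift_L2 f_integrable)

lemma periodized_measurable [measurable]: "periodized n \<in> borel_measurable (period_measure L)"
  using periodization_measurable[OF L_pos fg_integrable[of n]] by (simp add: periodized_def[abs_def])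

text \<open>
  The modulations \<open>e\<^sup>2\<^sup>\<pi>\<^sup>i\<^sup>m\<^sup>b\<^sup>x\<close> have period \<open>L = 1 / b\<close> and come out of the periodization, so that the inner
  products with a fixed \<open>n\<close> are the Fourier coefficients of \<open>periodized n\<close>.
\<close>

lemma inner_gabor_eq:
  "L2_inner f (gabor g a b (m, n)) = (LINT x|period_measure L. periodized n x * cnj (trig_mono L m x))"
proof -
  have "integrable lebesgue (\<lambda>y. f y * cnj (gabor g a b (m, n) y))"
    by (intro integrable_mult_cnj f_measurable gabor_L2 f_integrable)
  from integral_periodization[OF L_pos this]
  have "L2_inner f (gabor g a b (m, n))
    = (LINT x|period_measure L. (\<Sum>\<^sub>\<infinity>k::int. f (x + of_int k * L) * cnj (gabor g a b (m, n) (x + of_int k * L))))"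
    by (simp add: L2_inner_def)
  also have "\<dots> = (LINT x|period_measure L. periodized n x * cnj (trig_mono L m x))"
  proof (rule Bochner_Integration.integral_cong[OF refl])
    fix x
    have "f (x + of_int k * L) * cnj (gabor g a b (m, n) (x + of_int k * L))
      = f (x + of_int k * L) * cnj (g_shift n (x + of_int k * L)) * cnj (trig_mono L m x)" for k :: int
      using trig_mono_periodic[of L m x k] L_pos by (simp add: gabor_eq mult_ac)
    then show "(\<Sum>\<^sub>\<infinity>k::int. f (x + of_int k * L) * cnj (gabor g a b (m, n) (x + of_int k * L)))
        = periodized n x * cnj (trig_mono L m x)"
      unfolding periodized_def infsum_cmult_left'[symmetric] by (rule infsum_cong)
  qed
  finally show ?thesis .
qed

text \<open>
  For almost every \<open>x\<close> the samples of \<open>f\<close> along the orbit of \<open>x\<close> are square summable and vanish at the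
  points of \<open>N_G\<close>, so the estimates for the Gram matrix \<open>C x\<close> apply to them. Rows at points of \<open>N_G\<close>,
  where dominance may fail, carry coefficient zero.
\<close>

lemma fiber_bounds:
  "AE x in period_measure L.
     ennreal A * (\<Sum>\<^sub>\<infinity>k::int. ennreal ((cmod (f (x + of_int k * L)))\<^sup>2)) \<le> (\<Sum>\<^sub>\<infinity>n. ennreal ((cmod (periodized n x))\<^sup>2)) \<and>
     (\<Sum>\<^sub>\<infinity>n. ennreal ((cmod (periodized n x))\<^sup>2)) \<le> ennreal B * (\<Sum>\<^sub>\<infinity>k::int. ennreal ((cmod (f (x + of_int k * L)))\<^sup>2))"
proof -
  have "AE x in period_measure L. (\<lambda>k::int. complex_of_real ((cmod (f (x + of_int k * L)))\<^sup>2)) summable_on UNIV"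
    by (rule AE_summable_periodization[OF L_pos integrable_of_real[OF f_integrable]])
  moreover have "AE x in period_measure L. \<forall>n. (\<lambda>k::int. f (x + of_int k * L) * cnj (g_shift n (x + of_int k * L))) summable_on UNIV"
    unfolding AE_all_countable by (intro allI AE_summable_periodization[OF L_pos] fg_integrable)
  moreover have "AE x in period_measure L. \<forall>k::int. x + of_int k * L \<in> N_G g a \<longrightarrow> f (x + of_int k * L) = 0"
    by (rule AE_periodization[OF L_pos f_zero])
  ultimately show ?thesis
  proof eventually_elim
    case (elim x)
    interpret correlation_matrix "u x" "C x" B by (rule correlation_matrix)
    define c where "c k = f (x + of_int k * L)" for k :: int
    have c: "(\<lambda>k. (cmod (c k))\<^sup>2) summable_on UNIV"
      using summable_on_Re[OF elim(1)] by (simp add: c_def)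
    have periodized: "((\<lambda>k. c k * cnj (u x k n)) has_sum periodized n x) UNIV" for n
      using elim(2) unfolding periodized_def by (simp add: c_def u_def g_shift_def translation_def)
    have "A * (\<Sum>\<^sub>\<infinity>k. (cmod (c k))\<^sup>2) \<le> (\<Sum>\<^sub>\<infinity>n. (cmod (periodized n x))\<^sup>2)"
    proof (rule lower_bound[OF c periodized])
      fix k F assume "c k \<noteq> 0" "finite F" "k \<notin> F"
      then show "A + (\<Sum>l\<in>F. cmod (C x k l)) \<le> Re (C x k k)"
        using elim(3) by (intro diagonal_dominance) (auto simp: c_def)
    qed
    then have "ennreal A * ennreal (\<Sum>\<^sub>\<infinity>k. (cmod (c k))\<^sup>2) \<le> ennreal (\<Sum>\<^sub>\<infinity>n. (cmod (periodized n x))\<^sup>2)"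
      using A_pos by (simp add: infsum_nonneg ennreal_leI flip: ennreal_mult)
    moreover have "ennreal (\<Sum>\<^sub>\<infinity>n. (cmod (periodized n x))\<^sup>2) \<le> ennreal B * ennreal (\<Sum>\<^sub>\<infinity>k. (cmod (c k))\<^sup>2)"
      using upper_bound(2)[OF c periodized] B_pos by (simp add: infsum_nonneg ennreal_leI flip: ennreal_mult)
    ultimately show ?case
      unfolding ennreal_infsum[OF c, simplified] ennreal_infsum[OF upper_bound(1)[OF c periodized], simplified]
      by (simp add: c_def)
  qed
qed

definition fiber_energy :: ennreal where
  "fiber_energy = (\<integral>\<^sup>+x. (\<integral>\<^sup>+n. ennreal ((cmod (periodized n x))\<^sup>2) \<partial>count_space UNIV) \<partial>period_measure L)"

lemma norm_sq: "ennreal (Re (L2_inner f f)) = (\<integral>\<^sup>+y. ennreal ((cmod (f y))\<^sup>2) \<partial>lebesgue)"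
  and norm_sq_nonneg: "0 \<le> Re (L2_inner f f)"
proof -
  have "L2_inner f f = (LINT y|lebesgue. complex_of_real ((cmod (f y))\<^sup>2))"
    by (simp only: L2_inner_def complex_norm_square)
  then have "Re (L2_inner f f) = (LINT y|lebesgue. (cmod (f y))\<^sup>2)"
    by (simp only: integral_complex_of_real Re_complex_of_real)
  then show "ennreal (Re (L2_inner f f)) = (\<integral>\<^sup>+y. ennreal ((cmod (f y))\<^sup>2) \<partial>lebesgue)" "0 \<le> Re (L2_inner f f)"
    using f_integrable by (simp_all add: nn_integral_eq_integral)
qed

lemma fiber_energy_bounds:
  "ennreal (A * Re (L2_inner f f)) \<le> fiber_energy" "fiber_energy \<le> ennreal (B * Re (L2_inner f f))"
proof -
  let ?S = "\<lambda>x. \<integral>\<^sup>+k. ennreal ((cmod (f (x + of_int k * L)))\<^sup>2) \<partial>count_space (UNIV::int set)"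
  have "(\<lambda>(x, k). ennreal ((cmod (f (x + of_int k * L)))\<^sup>2)) \<in> borel_measurable (tiling_measure L)"
    using measurable_compose[OF tiling_map_measurable, of "\<lambda>y. ennreal ((cmod (f y))\<^sup>2)"]
    by (simp add: case_prod_beta')
  then have meas: "?S \<in> borel_measurable (period_measure L)"
    by (intro sigma_finite_measure.borel_measurable_nn_integral sigma_finite_measure_count_space)
  have S: "(\<integral>\<^sup>+x. ?S x \<partial>period_measure L) = ennreal (Re (L2_inner f f))"
    unfolding norm_sq by (rule nn_integral_tiling[OF L_pos, of "\<lambda>y. ennreal ((cmod (f y))\<^sup>2)"]) simp
  note bounds = fiber_bounds[unfolded infsum_ennreal_eq_nn_integral]
  have "(\<integral>\<^sup>+x. ennreal A * ?S x \<partial>period_measure L) \<le> fiber_energy"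
    unfolding fiber_energy_def using bounds by (intro nn_integral_mono_AE) auto
  then show "ennreal (A * Re (L2_inner f f)) \<le> fiber_energy"
    using A_pos norm_sq_nonneg by (simp add: nn_integral_cmult[OF meas] S ennreal_mult)
  have "fiber_energy \<le> (\<integral>\<^sup>+x. ennreal B * ?S x \<partial>period_measure L)"
    unfolding fiber_energy_def using bounds by (intro nn_integral_mono_AE) auto
  then show "fiber_energy \<le> ennreal (B * Re (L2_inner f f))"
    using B_pos norm_sq_nonneg by (simp add: nn_integral_cmult[OF meas] S ennreal_mult)
qed

lemma fiber_energy_swap: "fiber_energy = (\<integral>\<^sup>+n. (\<integral>\<^sup>+x. ennreal ((cmod (periodized n x))\<^sup>2) \<partial>period_measure L) \<partial>count_space UNIV)"
  unfolding fiber_energy_def by (rule nn_integral_count_space_nn_integral) auto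

text \<open>
  Parseval's identity in the frequency index \<open>m\<close>, then summation over \<open>n\<close>.
\<close>

lemma frame_sum: "(\<Sum>\<^sub>\<infinity>i. ennreal ((cmod (L2_inner f (gabor g a b i)))\<^sup>2)) = ennreal L * fiber_energy"
proof -
  have inner: "(\<integral>\<^sup>+m. ennreal ((cmod (L2_inner f (gabor g a b (m, n))))\<^sup>2) \<partial>count_space UNIV)
      = ennreal L * (\<integral>\<^sup>+x. ennreal ((cmod (periodized n x))\<^sup>2) \<partial>period_measure L)" for n
  proof -
    have "(\<integral>\<^sup>+x. ennreal ((cmod (periodized n x))\<^sup>2) \<partial>period_measure L) \<le> fiber_energy"
      unfolding fiber_energy_swap by (rule nn_integral_ge_point) simp
    also have "\<dots> < \<infinity>"
      using fiber_energy_bounds(2) by (auto simp: less_top[symmetric] top_unique)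
    finally have square_int: "integrable (period_measure L) (\<lambda>x. (cmod (periodized n x))\<^sup>2)"
      by (intro integrableI_bounded) auto
    note pars = parseval[OF L_pos periodized_measurable square_int, folded inner_gabor_eq]
    have "(\<integral>\<^sup>+m. ennreal ((cmod (L2_inner f (gabor g a b (m, n))))\<^sup>2) \<partial>count_space UNIV)
      = ennreal (\<Sum>\<^sub>\<infinity>m. (cmod (L2_inner f (gabor g a b (m, n))))\<^sup>2)"
      by (subst ennreal_infsum[OF has_sum_imp_summable[OF pars]]) (simp_all add: infsum_ennreal_eq_nn_integral)
    also have "\<dots> = ennreal L * (\<integral>\<^sup>+x. ennreal ((cmod (periodized n x))\<^sup>2) \<partial>period_measure L)"
      using L_pos square_int by (simp add: infsumI[OF pars] ennreal_mult nn_integral_eq_integral)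
    finally show ?thesis .
  qed
  have "(\<Sum>\<^sub>\<infinity>i. ennreal ((cmod (L2_inner f (gabor g a b i)))\<^sup>2))
    = (\<integral>\<^sup>+n. (\<integral>\<^sup>+m. ennreal ((cmod (L2_inner f (gabor g a b (m, n))))\<^sup>2) \<partial>count_space UNIV) \<partial>count_space UNIV)"
    unfolding infsum_ennreal_eq_nn_integral by (rule nn_integral_snd_count_space[symmetric])
  also have "\<dots> = ennreal L * fiber_energy"
    unfolding inner fiber_energy_swap by (rule nn_integral_cmult) simp
  finally show ?thesis .
qed

lemma frame_inequalities:
  "(\<lambda>i. (cmod (L2_inner f (gabor g a b i)))\<^sup>2) summable_on UNIV"
  "A / b * Re (L2_inner f f) \<le> (\<Sum>\<^sub>\<infinity>i. (cmod (L2_inner f (gabor g a b i)))\<^sup>2)"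
  "(\<Sum>\<^sub>\<infinity>i. (cmod (L2_inner f (gabor g a b i)))\<^sup>2) \<le> B / b * Re (L2_inner f f)"
proof -
  let ?\<Sigma> = "\<Sum>\<^sub>\<infinity>i. ennreal ((cmod (L2_inner f (gabor g a b i)))\<^sup>2)"
  have "ennreal L * ennreal (A * Re (L2_inner f f)) \<le> ?\<Sigma>"
    unfolding frame_sum by (intro mult_left_mono fiber_energy_bounds) simp
  then have lo: "ennreal (A / b * Re (L2_inner f f)) \<le> ?\<Sigma>"
    using L_pos A_pos norm_sq_nonneg by (simp add: L_def flip: ennreal_mult)
  have "?\<Sigma> \<le> ennreal L * ennreal (B * Re (L2_inner f f))"
    unfolding frame_sum by (intro mult_left_mono fiber_energy_bounds) simp
  then have up: "?\<Sigma> \<le> ennreal (B / b * Re (L2_inner f f))"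
    using L_pos B_pos norm_sq_nonneg by (simp add: L_def flip: ennreal_mult)
  then have "?\<Sigma> < \<infinity>"
    by (auto simp: less_top[symmetric] top_unique)
  then show sum: "(\<lambda>i. (cmod (L2_inner f (gabor g a b i)))\<^sup>2) summable_on UNIV"
    by (rule summable_on_if_ennreal_finite) simp
  show "A / b * Re (L2_inner f f) \<le> (\<Sum>\<^sub>\<infinity>i. (cmod (L2_inner f (gabor g a b i)))\<^sup>2)"
    using lo unfolding ennreal_infsum[OF sum zero_le_power2, symmetric]
    by (simp add: ennreal_le_iff infsum_nonneg)
  show "(\<Sum>\<^sub>\<infinity>i. (cmod (L2_inner f (gabor g a b i)))\<^sup>2) \<le> B / b * Re (L2_inner f f)"
    using up B_pos b_pos norm_sq_nonneg unfolding ennreal_infsum[OF sum zero_le_power2, symmetric]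
    by (simp add: ennreal_le_iff)
qed

end

lemma gabor_frame: "frame_with_bounds L2_inner (L2_off (N_G g a)) UNIV (gabor g a b) (A / b) (B / b)"
  unfolding frame_with_bounds_def
  using gabor_in_L2_off frame_inequalities A_pos B_pos b_pos by auto

end

theorem theorem2p1:
  fixes g :: "real \<Rightarrow> complex" and a b A B :: real
  assumes "g \<in> L2" and "0 < a" and "0 < b"
    and "ereal A = (INF x\<in>{0..a} - N_G g a.
           enn2ereal (G_fun g a x) - enn2ereal (\<Sum>\<^sub>\<infinity>k\<in>UNIV - {0}. abs_corr g a b k x))"
    and "0 < A"
    and "ereal B = (SUP x\<in>{0..a}. enn2ereal (\<Sum>\<^sub>\<infinity>k\<in>UNIV. abs_corr g a b k x))"
  shows "frame_with_bounds L2_inner (L2_off (N_G g a)) UNIV (gabor g a b) (A / b) (B / b)"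
proof -
  let ?corr = "\<lambda>K x. \<Sum>\<^sub>\<infinity>k\<in>K. abs_corr g a b k x"
  \<comment> \<open>The hypotheses concern one period \<open>[0, a]\<close>; \<open>a\<close>-periodicity extends them to the line.\<close>
  have reduce: "\<exists>j::int. x - of_int j * a \<in> {0..a}" for x
    using ex_period_shift[OF \<open>0 < a\<close>, of x] by force
  have upper: "?corr UNIV x \<le> ennreal B" for x
  proof -
    obtain j :: int where j: "x - of_int j * a \<in> {0..a}" using reduce by blast
    have "enn2ereal (?corr UNIV (x - of_int j * a)) \<le> ereal B"
      unfolding assms(6) using j by (rule SUP_upper)
    then have "?corr UNIV (x - of_int j * a) \<le> ennreal B"
      by (metis e2ennreal_enn2ereal e2ennreal_mono e2ennreal_ereal)
    then show ?thesis
      using abs_corr_periodic[of g a b _ "x - of_int j * a" j] by simp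
  qed
  have lower: "ennreal A + ?corr (UNIV - {0}) x \<le> G_fun g a x" if x: "x \<notin> N_G g a" for x
  proof -
    obtain j :: int where j: "x - of_int j * a \<in> {0..a}" using reduce by blast
    have G: "G_fun g a (x - of_int j * a) = G_fun g a x"
      using G_fun_periodic[of g a "x - of_int j * a" j] by simp
    have c: "?corr K (x - of_int j * a) = ?corr K x" for K
      using abs_corr_periodic[of g a b _ "x - of_int j * a" j] by simp
    have "x - of_int j * a \<in> {0..a} - N_G g a"
      using j x by (simp add: N_G_def G)
    then have "ereal A \<le> enn2ereal (G_fun g a (x - of_int j * a)) - enn2ereal (?corr (UNIV - {0}) (x - of_int j * a))"
      unfolding assms(4) by (rule INF_lower)
    then have le: "ereal A \<le> enn2ereal (G_fun g a x) - enn2ereal (?corr (UNIV - {0}) x)"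
      by (simp only: G c)
    have "?corr (UNIV - {0}) x \<le> ?corr UNIV x"
      by (rule infsum_mono_neutral) (auto intro!: nonneg_summable_on_complete)
    then have "?corr (UNIV - {0}) x < \<infinity>"
      using upper[of x] ennreal_less_top[of B] by (metis infinity_ennreal_def le_less_trans)
    then obtain s where s: "?corr (UNIV - {0}) x = ennreal s" "0 \<le> s"
      by (cases "?corr (UNIV - {0}) x") auto
    have "ereal A + ereal s \<le> enn2ereal (G_fun g a x)"
      using le s by (cases "enn2ereal (G_fun g a x)") (auto simp: enn2ereal_ennreal)
    then have "e2ennreal (ereal (A + s)) \<le> G_fun g a x"
      by (metis e2ennreal_enn2ereal e2ennreal_mono plus_ereal.simps(1))
    then show ?thesis
      using s \<open>0 < A\<close> by simp
  qed
  \<comment> \<open>The infimum over the empty set is \<open>\<infinity>\<close>, whereas \<open>A\<close> is real.\<close>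
  have "{0..a} - N_G g a \<noteq> {}"
  proof
    assume "{0..a} - N_G g a = {}"
    with assms(4) have "ereal A = \<infinity>"
      by (simp only: image_empty Inf_empty top_ereal_def)
    then show False by simp
  qed
  then obtain x where x: "x \<notin> N_G g a" by blast
  have "ennreal A \<le> ennreal A + ?corr (UNIV - {0}) x"
    by simp
  also have "\<dots> \<le> ennreal B"
    using lower[OF x] G_fun_le_corr_sum upper[of x] by (blast intro: order_trans)
  finally have "0 < B"
    using \<open>0 < A\<close> by (simp add: ennreal_le_iff2)
  interpret gabor_estimates g a b A B
    by unfold_locales (use assms upper lower \<open>0 < B\<close> in auto)
  show ?thesis by (rule gabor_frame)
qed

end
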